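(* For the indivisible coflow scheduling problem with precedence constraints in an identical parallel network with $m$ cores, in the special case where all coflows are released at time zero, the algorithm coflow-driven-list-scheduling has an approximation ratio of at most $4m\mu$ for minimizing the total weighted coflow completion time $\sum_{k\in\mathcal{K}} w_k C_k$, where $\mu$ is the maximum number of coflows on a directed path of the precedence graph.
   Context: Identical parallel network: there are $m\ge 1$ identical network cores, each an $N\times N$ non-blocking switch. Source servers form the set $\mathcal{I}=\{1,\dots,N\}$ and destination servers the set $\mathcal{J}=\{1,\dots,N\}$; in every core, input port $i$ is connected to source server $i$ and output port $j$ to destination server $j$, and all links have unit capacity. An instance is a finite set $\mathcal{K}$ of coflows; coflow $k$ has a demand matrix $D^{(k)}=(d_{ijk})_{i,j=1}^N$ of nonnegative integers, a release time $r_k\ge 0$ and a nonnegative weight $w_k$. A flow is a triple $(i,j,k)$ with $d_{ijk}>0$: $d_{ijk}$ units of data to be sent from input $i$ to output $j$. In a feasible schedule, at every time, in each core each input port sends at total rate at most $1$ and each output port receives at total rate at most $1$, and no data of coflow $k$ is sent before $r_k$. In the indivisible problem, all flows of a coflow must be transmitted through the same core. Precedence constraints are given by a directed acyclic graph $G=(\mathcal{K},E)$: if $(k',k)\in E$ (written $k'\prec k$), no flow of $k$ may be transmitted before all flows of $k'$ have completed. A flow/coflow is ready when all flows of all predecessor coflows have completed. The completion time $C_k$ of coflow $k$ is the completion time of its last flow. $\mu$ is the maximum number of coflows on a directed path in $G$. An algorithm has approximation ratio at most $\alpha$ if on every instance its schedule has objective value at most $\alpha$ times the optimum. Let $L_{ik}=\sum_{j=1}^N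 d_{ijk}$ and $L_{jk}=\sum_{i=1}^N d_{ijk}$. Linear program (LP-I), variables $C_k$: minimize $\sum_k w_kC_k$ subject to $C_k\ge r_k+L_{ik}$ and $C_k\ge r_k+L_{jk}$ for all $k,i,j$; $C_k\ge C_{k'}+L_{ik}$ and $C_k\ge C_{k'}+L_{jk}$ for all $i,j$ and $k'\prec k$; for every input $i$ and every $S\subseteq\mathcal{K}$: $\sum_{k\in S}L_{ik}C_k\ge\frac{1}{2m}\big(\sum_{k\in S}L_{ik}^2+(\sum_{k\in S}L_{ik})^2\big)$; and the same for every output $j$ with $L_{jk}$ in place of $L_{ik}$. Algorithm coflow-driven-list-scheduling: compute an optimal solution $\bar C$ of LP-I. Initialize $load_I(i,h)=load_O(j,h)=0$ and $\mathcal{A}_h=\emptyset$ for all ports and cores $h\in\{1,\dots,m\}$. For every coflow $k$ in non-decreasing order of $\bar C_k$ (ties arbitrary): choose $h^*\in\arg\min_h \max_{i,j}\big(load_I(i,h)+load_O(j,h)+L_{ik}+L_{jk}\big)$, add $k$ to $\mathcal{A}_{h^*}$, and for all $i,j$ increase $load_I(i,h^* )$ by $L_{ik}$ and $load_O(j,h^* )$ by $L_{jk}$. Then in each core $h$ in parallel: wait until the first coflow is released; while some flow is incomplete, list the ready, released and incomplete flows of the coflows in $\mathcal{A}_h$ in non-decreasing order of $\bar C_k$ of their coflows, go through this list and schedule each flow $f=(i,j,k)$ if the link $(i,j)$ is idle (neither input port $i$ nor output port $j$ of core $h$ is used by an already scheduled flow); transmit the scheduled flows at rate $1$ until some new flow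 becomes ready, completes or is released, and repeat. *)

theory Defs
  imports "HOL-Analysis.Analysis"
begin

record 'k coflow_instance =
  cores :: nat
  ports :: nat
  coflows :: "'k set"
  demand :: "nat \<Rightarrow> nat \<Rightarrow> 'k \<Rightarrow> nat"
  release :: "'k \<Rightarrow> real"
  weight :: "'k \<Rightarrow> real"
  prec :: "('k \<times> 'k) set"

(* (k', k) \<in> prec I means that k' precedes k. *)
definition valid_instance :: "'k coflow_instance \<Rightarrow> bool" where
  "valid_instance I \<longleftrightarrow>
     cores I \<ge> 1 \<and> finite (coflows I) \<and>
     (\<forall>k\<in>coflows I. release I k \<ge> 0 \<and> weight I k \<ge> 0) \<and>
     prec I \<subseteq> coflows I \<times> coflows I \<and> acyclic (prec I)"

type_synonym 'k flow = "nat \<times> nat \<times> 'k"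

fun inp :: "'k flow \<Rightarrow> nat" where "inp (i, j, k) = i"
fun outp :: "'k flow \<Rightarrow> nat" where "outp (i, j, k) = j"
fun cof :: "'k flow \<Rightarrow> 'k" where "cof (i, j, k) = k"

fun size_of :: "'k coflow_instance \<Rightarrow> 'k flow \<Rightarrow> real" where
  "size_of I (i, j, k) = real (demand I i j k)"

definition flows :: "'k coflow_instance \<Rightarrow> 'k flow set" where
  "flows I = {(i, j, k). i \<in> {1..ports I} \<and> j \<in> {1..ports I} \<and> k \<in> coflows I \<and> demand I i j k > 0}"

definition flows_of :: "'k coflow_instance \<Rightarrow> 'k \<Rightarrow> 'k flow set" where
  "flows_of I k = {f \<in> flows I. cof f = k}"

definition L_in :: "'k coflow_instance \<Rightarrow> nat \<Rightarrow> 'k \<Rightarrow> real" where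
  "L_in I i k = (\<Sum>j = 1..ports I. real (demand I i j k))"

definition L_out :: "'k coflow_instance \<Rightarrow> nat \<Rightarrow> 'k \<Rightarrow> real" where
  "L_out I j k = (\<Sum>i = 1..ports I. real (demand I i j k))"

(* The transitive closure makes precedence pass through coflows whose demand matrix is zero
   (k' before k before k'', where k has no flow).  If every coflow has a flow, then the
   constraints below are equivalent to those given by the direct edges alone. *)
definition predecessors :: "'k coflow_instance \<Rightarrow> 'k \<Rightarrow> 'k set" where
  "predecessors I k = {k'. (k', k) \<in> (prec I)\<^sup>+}"

(* \<mu>; for acyclic prec I a directed path has no repeated vertices. *)
definition max_path_coflows :: "'k coflow_instance \<Rightarrow> nat" where
  "max_path_coflows I =
     Max (length ` {p. set p \<subseteq> coflows I \<and> successively (\<lambda>k' k. (k', k) \<in> prec I) p})"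


text \<open>A schedule gives the rate \<open>S h f t\<close> at which core \<open>h\<close> transmits flow \<open>f\<close> at
  time \<open>t \<ge> 0\<close>.\<close>

type_synonym 'k schedule = "nat \<Rightarrow> 'k flow \<Rightarrow> real \<Rightarrow> real"

definition sent :: "'k coflow_instance \<Rightarrow> 'k schedule \<Rightarrow> 'k flow \<Rightarrow> real \<Rightarrow> real" where
  "sent I S f t = (\<Sum>h = 1..cores I. integral {0..t} (S h f))"

definition flow_completion :: "'k coflow_instance \<Rightarrow> 'k schedule \<Rightarrow> 'k flow \<Rightarrow> real" where
  "flow_completion I S f = Inf {t. 0 \<le> t \<and> sent I S f t \<ge> size_of I f}"

(* A coflow without flows is complete as soon as it is released and all flows of all its
   predecessors are complete. *)
definition completion :: "'k coflow_instance \<Rightarrow> 'k schedule \<Rightarrow> 'k \<Rightarrow> real" where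
  "completion I S k =
     (if flows_of I k \<noteq> {} then Max (flow_completion I S ` flows_of I k)
      else Max (insert (release I k)
                  (flow_completion I S ` (\<Union>k'\<in>predecessors I k. flows_of I k'))))"

definition objective :: "'k coflow_instance \<Rightarrow> 'k schedule \<Rightarrow> real" where
  "objective I S = (\<Sum>k\<in>coflows I. weight I k * completion I S k)"

definition feasible :: "'k coflow_instance \<Rightarrow> 'k schedule \<Rightarrow> bool" where
  "feasible I S \<longleftrightarrow>
     (\<forall>h\<in>{1..cores I}. \<forall>f\<in>flows I.
        (\<forall>t\<ge>0. S h f t \<ge> 0 \<and> S h f integrable_on {0..t})) \<and>
     (\<forall>h\<in>{1..cores I}. \<forall>t\<ge>0. \<forall>i\<in>{1..ports I}. (\<Sum>f\<in>{f\<in>flows I. inp f = i}. S h f t) \<le> 1) \<and>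
     (\<forall>h\<in>{1..cores I}. \<forall>t\<ge>0. \<forall>j\<in>{1..ports I}. (\<Sum>f\<in>{f\<in>flows I. outp f = j}. S h f t) \<le> 1) \<and>
     (\<forall>f\<in>flows I. \<forall>t\<ge>0. sent I S f t \<le> size_of I f) \<and>
     (\<forall>f\<in>flows I. \<exists>t\<ge>0. sent I S f t = size_of I f) \<and>
     (\<forall>h\<in>{1..cores I}. \<forall>f\<in>flows I. \<forall>t\<ge>0. t < release I (cof f) \<longrightarrow> S h f t = 0) \<and>
     (\<forall>h\<in>{1..cores I}. \<forall>f\<in>flows I. \<forall>k'\<in>predecessors I (cof f). \<forall>f'\<in>flows_of I k'.
        \<forall>t\<ge>0. t < flow_completion I S f' \<longrightarrow> S h f t = 0)"

definition indivisible :: "'k coflow_instance \<Rightarrow> 'k schedule \<Rightarrow> bool" where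
  "indivisible I S \<longleftrightarrow>
     (\<forall>k\<in>coflows I. \<exists>h\<in>{1..cores I}. \<forall>f\<in>flows_of I k.
        \<forall>h'\<in>{1..cores I}. h' \<noteq> h \<longrightarrow> (\<forall>t\<ge>0. S h' f t = 0))"

definition optimum :: "'k coflow_instance \<Rightarrow> real" where
  "optimum I = (INF S\<in>{S. feasible I S \<and> indivisible I S}. objective I S)"


definition lp_feasible :: "'k coflow_instance \<Rightarrow> ('k \<Rightarrow> real) \<Rightarrow> bool" where
  "lp_feasible I C \<longleftrightarrow>
     (\<forall>k\<in>coflows I. \<forall>i\<in>{1..ports I}. C k \<ge> release I k + L_in I i k) \<and>
     (\<forall>k\<in>coflows I. \<forall>j\<in>{1..ports I}. C k \<ge> release I k + L_out I j k) \<and>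
     (\<forall>(k', k)\<in>prec I. \<forall>i\<in>{1..ports I}. C k \<ge> C k' + L_in I i k) \<and>
     (\<forall>(k', k)\<in>prec I. \<forall>j\<in>{1..ports I}. C k \<ge> C k' + L_out I j k) \<and>
     (\<forall>i\<in>{1..ports I}. \<forall>S\<subseteq>coflows I.
        (\<Sum>k\<in>S. L_in I i k * C k)
          \<ge> 1 / (2 * real (cores I)) * ((\<Sum>k\<in>S. (L_in I i k)\<^sup>2) + (\<Sum>k\<in>S. L_in I i k)\<^sup>2)) \<and>
     (\<forall>j\<in>{1..ports I}. \<forall>S\<subseteq>coflows I.
        (\<Sum>k\<in>S. L_out I j k * C k)
          \<ge> 1 / (2 * real (cores I)) * ((\<Sum>k\<in>S. (L_out I j k)\<^sup>2) + (\<Sum>k\<in>S. L_out I j k)\<^sup>2))"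

definition lp_optimal :: "'k coflow_instance \<Rightarrow> ('k \<Rightarrow> real) \<Rightarrow> bool" where
  "lp_optimal I C \<longleftrightarrow> lp_feasible I C \<and>
     (\<forall>C'. lp_feasible I C' \<longrightarrow>
        (\<Sum>k\<in>coflows I. weight I k * C k) \<le> (\<Sum>k\<in>coflows I. weight I k * C' k))"


text \<open>Assignment of coflows to cores: \<open>ks\<close> is the order in which the coflows are considered
  and \<open>a k\<close> is the core chosen for \<open>k\<close>.  The loads are those after the first \<open>n\<close> coflows
  of \<open>ks\<close> have been assigned.\<close>

definition load_I :: "'k coflow_instance \<Rightarrow> 'k list \<Rightarrow> ('k \<Rightarrow> nat) \<Rightarrow> nat \<Rightarrow> nat \<Rightarrow> nat \<Rightarrow> real" where
  "load_I I ks a n i h = (\<Sum>k\<in>{k \<in> set (take n ks). a k = h}. L_in I i k)"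

definition load_O :: "'k coflow_instance \<Rightarrow> 'k list \<Rightarrow> ('k \<Rightarrow> nat) \<Rightarrow> nat \<Rightarrow> nat \<Rightarrow> nat \<Rightarrow> real" where
  "load_O I ks a n j h = (\<Sum>k\<in>{k \<in> set (take n ks). a k = h}. L_out I j k)"

definition core_assignment ::
  "'k coflow_instance \<Rightarrow> ('k \<Rightarrow> real) \<Rightarrow> 'k list \<Rightarrow> ('k \<Rightarrow> nat) \<Rightarrow> bool" where
  "core_assignment I C ks a \<longleftrightarrow>
     set ks = coflows I \<and> distinct ks \<and> sorted_wrt (\<lambda>k k'. C k \<le> C k') ks \<and>
     (\<forall>n<length ks.
        is_arg_min
          (\<lambda>h. Max {load_I I ks a n i h + load_O I ks a n j h + L_in I i (ks ! n) + L_out I j (ks ! n)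
                    | i j. i \<in> {1..ports I} \<and> j \<in> {1..ports I}})
          (\<lambda>h. h \<in> {1..cores I}) (a (ks ! n)))"


text \<open>List scheduling.  \<open>X n h\<close> is the set of flows transmitted by core \<open>h\<close> between the
  \<open>n\<close>-th and the \<open>(n+1)\<close>-st event.  It determines the event times and the remaining amounts
  of data.\<close>

fun pick_greedily :: "'k flow list \<Rightarrow> 'k flow set \<Rightarrow> 'k flow set" where
  "pick_greedily [] B = B"
| "pick_greedily (f # fs) B =
     pick_greedily fs (if \<forall>g\<in>B. inp g \<noteq> inp f \<and> outp g \<noteq> outp f then insert f B else B)"

definition active_flows ::
  "'k coflow_instance \<Rightarrow> ('k \<Rightarrow> nat) \<Rightarrow> nat \<Rightarrow> real \<Rightarrow> ('k flow \<Rightarrow> real) \<Rightarrow> 'k flow set" where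
  "active_flows I a h t R =
     {f \<in> flows I. a (cof f) = h \<and> R f > 0 \<and> release I (cof f) \<le> t \<and>
        (\<forall>k'\<in>predecessors I (cof f). \<forall>f'\<in>flows_of I k'. R f' = 0)}"

(* Flows become ready only when other flows complete, so completions of transmitted flows and
   releases are the only events.  Events of all cores are merged: every core draws up its list
   again at every event, in whichever core it occurs.  If nothing has changed for a core, it may
   keep its old list, so runs in which each core reacts only to its own events are covered. *)
definition time_to_event ::
  "'k coflow_instance \<Rightarrow> real \<Rightarrow> ('k flow \<Rightarrow> real) \<Rightarrow> (nat \<Rightarrow> 'k flow set) \<Rightarrow> real" where
  "time_to_event I t R Y =
     (let D = R ` (\<Union>h\<in>{1..cores I}. Y h) \<union> {release I k - t | k. k \<in> coflows I \<and> release I k > t}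
      in if D = {} then 0 else Min D)"

primrec run_state ::
  "'k coflow_instance \<Rightarrow> (nat \<Rightarrow> nat \<Rightarrow> 'k flow set) \<Rightarrow> nat \<Rightarrow> real \<times> ('k flow \<Rightarrow> real)" where
  "run_state I X 0 = (0, size_of I)"
| "run_state I X (Suc n) =
     (let (t, R) = run_state I X n; \<delta> = time_to_event I t R (X n)
      in (t + \<delta>, \<lambda>f. if f \<in> (\<Union>h\<in>{1..cores I}. X n h) then R f - \<delta> else R f))"

abbreviation event_time :: "'k coflow_instance \<Rightarrow> (nat \<Rightarrow> nat \<Rightarrow> 'k flow set) \<Rightarrow> nat \<Rightarrow> real" where
  "event_time I X n \<equiv> fst (run_state I X n)"

abbreviation remaining ::
  "'k coflow_instance \<Rightarrow> (nat \<Rightarrow> nat \<Rightarrow> 'k flow set) \<Rightarrow> nat \<Rightarrow> 'k flow \<Rightarrow> real" where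
  "remaining I X n \<equiv> snd (run_state I X n)"

(* After the last flow has completed, all lists are empty and nothing is transmitted. *)
definition list_scheduling_run ::
  "'k coflow_instance \<Rightarrow> ('k \<Rightarrow> real) \<Rightarrow> ('k \<Rightarrow> nat) \<Rightarrow> (nat \<Rightarrow> nat \<Rightarrow> 'k flow set) \<Rightarrow> bool" where
  "list_scheduling_run I C a X \<longleftrightarrow>
     (\<forall>n. \<forall>h\<in>{1..cores I}. \<exists>fs.
        set fs = active_flows I a h (event_time I X n) (remaining I X n) \<and> distinct fs \<and>
        sorted_wrt (\<lambda>f g. C (cof f) \<le> C (cof g)) fs \<and>
        X n h = pick_greedily fs {})"

definition run_schedule :: "'k coflow_instance \<Rightarrow> (nat \<Rightarrow> nat \<Rightarrow> 'k flow set) \<Rightarrow> 'k schedule" where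
  "run_schedule I X h f t =
     (if \<exists>n. event_time I X n \<le> t \<and> t < event_time I X (Suc n) \<and> f \<in> X n h then 1 else 0)"

text \<open>The schedules that the algorithm can produce, over all optimal solutions of the linear
  program and all ways of breaking ties.\<close>

definition coflow_driven_list_scheduling :: "'k coflow_instance \<Rightarrow> 'k schedule \<Rightarrow> bool" where
  "coflow_driven_list_scheduling I S \<longleftrightarrow>
     (\<exists>C ks a X. lp_optimal I C \<and> core_assignment I C ks a \<and> list_scheduling_run I C a X \<and>
        S = run_schedule I X)"

end

theory Submission
  imports Defs
begin

text \<open>
  While a flow \<open>(i, j, k)\<close> is ready but incomplete, greedy selection keeps port \<open>i\<close> or port \<open>j\<close>
  of its core busy with flows of coflows \<open>k'\<close> with \<open>C k' \<le> C k\<close>.  It therefore completes within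
  the total load that these coflows put on \<open>i\<close> and on \<open>j\<close>, counted over all cores, and each of the
  two loads is at most \<open>2 m C k\<close> by the subset constraint of the linear program.
  Following, from each flow, the predecessor flow that completes last yields a directed path with
  at most \<open>\<mu>\<close> coflows along which \<open>C\<close> is non-decreasing, so coflow \<open>k\<close> completes by
  \<open>4 m \<mu> C k\<close>.  The completion times of any feasible indivisible schedule satisfy the linear
  program, hence its optimal value is at most that of the best schedule.\<close>

section \<open>Greedy selection\<close>

lemma pick_greedily_subset: "pick_greedily fs B \<subseteq> B \<union> set fs"
proof (induction fs arbitrary: B)
  case (Cons f fs)
  show ?case
    unfolding pick_greedily.simps by (rule order_trans[OF Cons.IH]) auto
qed simp

lemma pick_greedily_superset: "B \<subseteq> pick_greedily fs B"
proof (induction fs arbitrary: B)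
  case (Cons f fs)
  show ?case
    unfolding pick_greedily.simps by (rule order_trans[OF _ Cons.IH]) auto
qed simp

lemma pick_greedily_ports:
  assumes "inj_on inp B" "inj_on outp B"
  shows "inj_on inp (pick_greedily fs B) \<and> inj_on outp (pick_greedily fs B)"
  using assms
proof (induction fs arbitrary: B)
  case (Cons f fs)
  show ?case
    unfolding pick_greedily.simps by (rule Cons.IH) (use Cons.prems in \<open>auto simp: inj_on_def\<close>)
qed simp

text \<open>A listed flow is rejected only because an already chosen flow uses one of its ports, and
  that flow was in \<open>B\<close> or stands earlier in the list, where \<open>r\<close> relates it
  to \<open>f\<close>. Reflexivity of \<open>r\<close> covers the case that \<open>f\<close> itself
  is chosen.\<close>

lemma pick_greedily_blocking:
  assumes "f \<in> set fs" "sorted_wrt r fs" "\<And>g. r g g"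
  shows "\<exists>g\<in>pick_greedily fs B. (inp g = inp f \<or> outp g = outp f) \<and> (g \<in> B \<or> r g f)"
  using assms(1,2)
proof (induction fs arbitrary: B)
  case (Cons x fs)
  let ?B = "if \<forall>g\<in>B. inp g \<noteq> inp x \<and> outp g \<noteq> outp x then insert x B else B"
  show ?case
  proof (cases "f = x")
    case True
    have "\<exists>g\<in>?B. (inp g = inp f \<or> outp g = outp f) \<and> (g \<in> B \<or> r g f)"
      using True assms(3) by auto
    then show ?thesis
      using pick_greedily_superset[of ?B fs] unfolding pick_greedily.simps by blast
  next
    case False
    then obtain g where g: "g \<in> pick_greedily fs ?B" "inp g = inp f \<or> outp g = outp f"
      "g \<in> ?B \<or> r g f"
      using Cons.IH[of ?B] Cons.prems by auto
    moreover have "r x f"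
      using Cons.prems False by auto
    ultimately have "g \<in> B \<or> r g f"
      by (auto split: if_splits)
    then show ?thesis
      using g unfolding pick_greedily.simps by blast
  qed
qed simp

section \<open>Flows and port loads\<close>

lemma finite_flows:
  assumes "valid_instance I"
  shows "finite (flows I)"
proof (rule finite_subset)
  show "flows I \<subseteq> {1..ports I} \<times> {1..ports I} \<times> coflows I"
    by (auto simp: flows_def)
qed (use assms in \<open>auto simp: valid_instance_def\<close>)

lemma cof_in_coflows: "f \<in> flows I \<Longrightarrow> cof f \<in> coflows I"
  by (auto simp: flows_def)

lemma inp_in_ports: "f \<in> flows I \<Longrightarrow> inp f \<in> {1..ports I}"
  by (auto simp: flows_def)

lemma outp_in_ports: "f \<in> flows I \<Longrightarrow> outp f \<in> {1..ports I}"
  by (auto simp: flows_def)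

lemma size_of_pos: "f \<in> flows I \<Longrightarrow> 0 < size_of I f"
  by (auto simp: flows_def)

lemma size_of_nonneg: "0 \<le> size_of I f"
  by (cases f) simp

lemma L_in_eq_sum_flows:
  assumes "k \<in> coflows I" "i \<in> {1..ports I}"
  shows "L_in I i k = (\<Sum>f\<in>{f\<in>flows_of I k. inp f = i}. size_of I f)"
proof -
  have "L_in I i k = (\<Sum>j\<in>{j\<in>{1..ports I}. demand I i j k > 0}. real (demand I i j k))"
    unfolding L_in_def by (rule sum.mono_neutral_right) auto
  also have "\<dots> = (\<Sum>f\<in>{f\<in>flows_of I k. inp f = i}. size_of I f)"
    by (rule sum.reindex_bij_witness[of _ outp "\<lambda>j. (i, j, k)"])
      (use assms in \<open>auto simp: flows_of_def flows_def\<close>)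
  finally show ?thesis .
qed

lemma L_out_eq_sum_flows:
  assumes "k \<in> coflows I" "j \<in> {1..ports I}"
  shows "L_out I j k = (\<Sum>f\<in>{f\<in>flows_of I k. outp f = j}. size_of I f)"
proof -
  have "L_out I j k = (\<Sum>i\<in>{i\<in>{1..ports I}. demand I i j k > 0}. real (demand I i j k))"
    unfolding L_out_def by (rule sum.mono_neutral_right) auto
  also have "\<dots> = (\<Sum>f\<in>{f\<in>flows_of I k. outp f = j}. size_of I f)"
    by (rule sum.reindex_bij_witness[of _ inp "\<lambda>i. (i, j, k)"])
      (use assms in \<open>auto simp: flows_of_def flows_def\<close>)
  finally show ?thesis .
qed

lemma L_in_nonneg: "0 \<le> L_in I i k"
  by (simp add: L_in_def sum_nonneg)

lemma L_out_nonneg: "0 \<le> L_out I j k"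
  by (simp add: L_out_def sum_nonneg)

lemma sum_flows_of:
  assumes "valid_instance I" "K \<subseteq> coflows I"
  shows "(\<Sum>f\<in>{f\<in>flows I. P f \<and> cof f \<in> K}. size_of I f)
    = (\<Sum>k\<in>K. \<Sum>f\<in>{f\<in>flows_of I k. P f}. size_of I f)"
proof -
  have K: "finite K"
    using assms finite_subset by (auto simp: valid_instance_def)
  have "{f\<in>flows I. P f \<and> cof f \<in> K} = (\<Union>k\<in>K. {f\<in>flows_of I k. P f})"
    by (auto simp: flows_of_def)
  then show ?thesis
    using sum.UNION_disjoint[of K "\<lambda>k. {f\<in>flows_of I k. P f}" "size_of I"] K finite_flows[OF assms(1)]
    by (auto simp: flows_of_def)
qed

lemma predecessors_trans:
  "k'' \<in> predecessors I k' \<Longrightarrow> k' \<in> predecessors I k \<Longrightarrow> k'' \<in> predecessors I k"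
  unfolding predecessors_def by auto

lemma predecessors_in_coflows:
  assumes "valid_instance I" "k' \<in> predecessors I k"
  shows "k' \<in> coflows I" "k \<in> coflows I"
proof -
  have "(prec I)\<^sup>+ \<subseteq> coflows I \<times> coflows I"
    using assms(1) trancl_subset_Sigma unfolding valid_instance_def by blast
  then show "k' \<in> coflows I" "k \<in> coflows I"
    using assms(2) unfolding predecessors_def by auto
qed

lemma wf_predecessors:
  assumes "valid_instance I"
  shows "wf {(k', k). k' \<in> predecessors I k}"
proof -
  have "finite (prec I)"
    using assms finite_subset by (auto simp: valid_instance_def)
  then have "wf ((prec I)\<^sup>+)"
    using assms by (intro wf_trancl finite_acyclic_wf) (auto simp: valid_instance_def)
  then show ?thesis
    by (simp add: predecessors_def)
qed

section \<open>Paths in the precedence graph\<close>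

abbreviation prec_path :: "'k coflow_instance \<Rightarrow> 'k list \<Rightarrow> bool" where
  "prec_path I p \<equiv> set p \<subseteq> coflows I \<and> successively (\<lambda>k' k. (k', k) \<in> prec I) p"

text \<open>Consecutive edges compose in the transitive closure, which is irreflexive by acyclicity.
  Distinctness bounds path lengths by the number of coflows, so the maximum defining \<mu> is over a
  finite set.\<close>

lemma distinct_prec_path:
  assumes "valid_instance I" "prec_path I p"
  shows "distinct p"
proof -
  have "successively (\<lambda>k' k. (k', k) \<in> (prec I)\<^sup>+) p"
    using assms(2) by (auto intro: successively_mono)
  then have "sorted_wrt (\<lambda>k' k. (k', k) \<in> (prec I)\<^sup>+) p"
    by (subst (asm) successively_conv_sorted_wrt) (auto intro!: transpI)
  then have "sorted_wrt (\<noteq>) p"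
    by (rule sorted_wrt_mono_rel[rotated]) (use assms(1) in \<open>auto simp: valid_instance_def acyclic_def\<close>)
  then show ?thesis
    by (simp add: distinct_conv_nth sorted_wrt_iff_nth_less) (metis linorder_neqE_nat)
qed

lemma length_prec_path_le:
  assumes "valid_instance I" "prec_path I p"
  shows "length p \<le> max_path_coflows I"
proof -
  have "length q \<le> card (coflows I)" if "prec_path I q" for q
  proof -
    have "card (set q) \<le> card (coflows I)"
      using that assms(1) by (intro card_mono) (auto simp: valid_instance_def)
    then show ?thesis
      using distinct_card[OF distinct_prec_path[OF assms(1) that]] by simp
  qed
  then have "length ` {q. prec_path I q} \<subseteq> {..card (coflows I)}"
    by auto
  then have "finite (length ` {q. prec_path I q})"
    by (rule finite_subset) simp
  then show ?thesis
    unfolding max_path_coflows_def using assms(2) by (intro Max_ge) auto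
qed

text \<open>A predecessor need not be joined by a direct edge; \<open>q\<close> collects the coflows
  on a chain of edges from \<open>k'\<close> to \<open>k\<close>, excluding \<open>k'\<close>
  itself.\<close>

lemma prec_path_extend:
  assumes "valid_instance I" "k' \<in> predecessors I k" "prec_path I p" "p \<noteq> []" "last p = k'"
  shows "\<exists>q. q \<noteq> [] \<and> last q = k \<and> prec_path I (p @ q)"
  using assms(2) unfolding predecessors_def mem_Collect_eq
proof (induction rule: trancl_induct)
  case (base k)
  then have "k \<in> coflows I"
    using assms(1) by (auto simp: valid_instance_def)
  then show ?case
    using base assms by (intro exI[of _ "[k]"]) (auto simp: successively_append_iff)
next
  case (step j k)
  then obtain q where q: "q \<noteq> []" "last q = j" "prec_path I (p @ q)"
    by blast
  have "k \<in> coflows I"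
    using step assms(1) by (auto simp: valid_instance_def)
  then show ?case
    using q step by (intro exI[of _ "q @ [k]"])
      (auto simp: successively_append_iff successively_append_iff[of _ "p @ q", simplified])
qed

section \<open>Consequences of the linear program\<close>

text \<open>With \<open>s\<close> the sum of the \<open>L k\<close>, dropping the squares and
  bounding each \<open>C k\<close> by \<open>c\<close> gives s^2 / (2 m) \<le> s c; then
  \<open>s\<close> cancels.\<close>

lemma sum_le_of_quadratic_bound:
  fixes L C :: "'k \<Rightarrow> real"
  assumes "finite A" "\<And>k. 0 \<le> L k" "0 < m" "0 \<le> c" "\<And>k. k \<in> A \<Longrightarrow> C k \<le> c"
    and "(\<Sum>k\<in>A. L k * C k) \<ge> 1 / (2 * m) * ((\<Sum>k\<in>A. (L k)\<^sup>2) + (\<Sum>k\<in>A. L k)\<^sup>2)"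
  shows "(\<Sum>k\<in>A. L k) \<le> 2 * m * c"
proof (cases "(\<Sum>k\<in>A. L k) = 0")
  case False
  let ?s = "\<Sum>k\<in>A. L k"
  have s: "0 < ?s"
    using False assms(2) by (simp add: order_less_le sum_nonneg)
  have "1 / (2 * m) * ?s\<^sup>2 \<le> 1 / (2 * m) * ((\<Sum>k\<in>A. (L k)\<^sup>2) + ?s\<^sup>2)"
    using assms(3) by (intro mult_left_mono) (auto intro: sum_nonneg)
  also have "\<dots> \<le> (\<Sum>k\<in>A. L k * C k)"
    by (rule assms(6))
  also have "\<dots> \<le> (\<Sum>k\<in>A. L k * c)"
    using assms(2,5) by (intro sum_mono mult_left_mono) auto
  also have "\<dots> = ?s * c"
    by (simp add: sum_distrib_right)
  finally have "?s * ?s \<le> ?s * (2 * m * c)"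
    using assms(3) by (simp add: field_simps power2_eq_square)
  then show ?thesis
    using s by simp
qed (use assms in simp)

text \<open>Each constraint of the linear program refers to a port; given that one exists, port 1
  serves.\<close>

lemma lp_feasible_nonneg:
  assumes "valid_instance I" "lp_feasible I C" "k \<in> coflows I" "1 \<le> ports I"
  shows "0 \<le> C k"
proof -
  have "release I k + L_in I 1 k \<le> C k"
    using assms unfolding lp_feasible_def by auto
  moreover have "0 \<le> release I k"
    using assms by (auto simp: valid_instance_def)
  ultimately show ?thesis
    using L_in_nonneg[of I 1 k] by linarith
qed

lemma lp_feasible_mono:
  assumes "lp_feasible I C" "1 \<le> ports I" "k' \<in> predecessors I k"
  shows "C k' \<le> C k"
  using assms(3) unfolding predecessors_def mem_Collect_eq
proof (induction rule: trancl_induct)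
  case (base k)
  then have "C k' + L_in I 1 k \<le> C k"
    using assms unfolding lp_feasible_def by auto
  then show ?case
    using L_in_nonneg[of I 1 k] by linarith
next
  case (step j k)
  then have "C j + L_in I 1 k \<le> C k"
    using assms unfolding lp_feasible_def by auto
  then show ?case
    using step.IH L_in_nonneg[of I 1 k] by linarith
qed

lemma lp_feasible_loads:
  assumes "valid_instance I" "lp_feasible I C" "k \<in> coflows I"
  shows "i \<in> {1..ports I} \<Longrightarrow>
      (\<Sum>f\<in>{f\<in>flows I. inp f = i \<and> C (cof f) \<le> C k}. size_of I f) \<le> 2 * real (cores I) * C k"
    and "j \<in> {1..ports I} \<Longrightarrow>
      (\<Sum>f\<in>{f\<in>flows I. outp f = j \<and> C (cof f) \<le> C k}. size_of I f) \<le> 2 * real (cores I) * C k"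
proof -
  \<comment> \<open>These are the coflows that list scheduling may rank no later than
    \<open>k\<close>, ties included; the subset constraint is applied to them.\<close>
  define A where "A = {k'\<in>coflows I. C k' \<le> C k}"
  have A: "A \<subseteq> coflows I" "finite A" "\<And>k'. k' \<in> A \<Longrightarrow> C k' \<le> C k"
    using assms(1) by (auto simp: A_def valid_instance_def)
  have cof: "{f\<in>flows I. P f \<and> C (cof f) \<le> C k} = {f\<in>flows I. P f \<and> cof f \<in> A}" for P
    using cof_in_coflows by (auto simp: A_def)
  have m: "0 < real (cores I)"
    using assms(1) by (auto simp: valid_instance_def)
  {
    assume i: "i \<in> {1..ports I}"
    have "(\<Sum>f\<in>{f\<in>flows I. inp f = i \<and> C (cof f) \<le> C k}. size_of I f) = (\<Sum>k\<in>A. L_in I i k)"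
      unfolding cof sum_flows_of[OF assms(1) A(1)]
      by (intro sum.cong refl L_in_eq_sum_flows[symmetric]) (use A i in auto)
    also have "\<dots> \<le> 2 * real (cores I) * C k"
    proof (rule sum_le_of_quadratic_bound[OF A(2) L_in_nonneg m _ A(3)])
      show "0 \<le> C k"
        by (rule lp_feasible_nonneg[OF assms]) (use i in auto)
    qed (use assms(2) i A(1) in \<open>auto simp: lp_feasible_def\<close>)
    finally show "(\<Sum>f\<in>{f\<in>flows I. inp f = i \<and> C (cof f) \<le> C k}. size_of I f)
      \<le> 2 * real (cores I) * C k" .
  }
  {
    assume j: "j \<in> {1..ports I}"
    have "(\<Sum>f\<in>{f\<in>flows I. outp f = j \<and> C (cof f) \<le> C k}. size_of I f) = (\<Sum>k\<in>A. L_out I j k)"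
      unfolding cof sum_flows_of[OF assms(1) A(1)]
      by (intro sum.cong refl L_out_eq_sum_flows[symmetric]) (use A j in auto)
    also have "\<dots> \<le> 2 * real (cores I) * C k"
    proof (rule sum_le_of_quadratic_bound[OF A(2) L_out_nonneg m _ A(3)])
      show "0 \<le> C k"
        by (rule lp_feasible_nonneg[OF assms]) (use j in auto)
    qed (use assms(2) j A(1) in \<open>auto simp: lp_feasible_def\<close>)
    finally show "(\<Sum>f\<in>{f\<in>flows I. outp f = j \<and> C (cof f) \<le> C k}. size_of I f)
      \<le> 2 * real (cores I) * C k" .
  }
qed

section \<open>Runs of list scheduling without release times\<close>

text \<open>\<open>C\<close> is only the priority key at first; the linear program enters with the
  assumption \<open>lp\<close> of a later context.\<close>

locale zero_release_run =
  fixes I :: "'k coflow_instance" and C :: "'k \<Rightarrow> real" and a :: "'k \<Rightarrow> nat"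
    and X :: "nat \<Rightarrow> nat \<Rightarrow> 'k flow set"
  assumes valid: "valid_instance I"
    and release_0: "\<forall>k\<in>coflows I. release I k = 0"
    and run: "list_scheduling_run I C a X"
    and core_of: "k \<in> coflows I \<Longrightarrow> a k \<in> {1..cores I}"
begin

section \<open>Event times, remaining volumes and termination\<close>

abbreviation e :: "nat \<Rightarrow> real" where "e n \<equiv> event_time I X n"
abbreviation R :: "nat \<Rightarrow> 'k flow \<Rightarrow> real" where "R n \<equiv> remaining I X n"
abbreviation sending :: "nat \<Rightarrow> 'k flow set" where "sending n \<equiv> (\<Union>h\<in>{1..cores I}. X n h)"

definition \<delta> :: "nat \<Rightarrow> real" where "\<delta> n = time_to_event I (e n) (R n) (X n)"

lemma e_0: "e 0 = 0" and R_0: "R 0 = size_of I"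
  by simp_all

lemma e_Suc: "e (Suc n) = e n + \<delta> n"
  by (simp add: \<delta>_def case_prod_beta Let_def)

lemma R_Suc: "R (Suc n) f = (if f \<in> sending n then R n f - \<delta> n else R n f)"
  by (simp add: \<delta>_def case_prod_beta Let_def)

declare run_state.simps [simp del]

lemma X_greedy:
  assumes "h \<in> {1..cores I}"
  obtains fs where "set fs = active_flows I a h (e n) (R n)"
    "sorted_wrt (\<lambda>f g. C (cof f) \<le> C (cof g)) fs" "X n h = pick_greedily fs {}"
  using run assms unfolding list_scheduling_run_def by blast

lemma X_active:
  assumes "h \<in> {1..cores I}"
  shows "X n h \<subseteq> active_flows I a h (e n) (R n)"
  using X_greedy[OF assms] pick_greedily_subset by (metis Un_empty_left)

lemma X_core: "h \<in> {1..cores I} \<Longrightarrow> f \<in> X n h \<Longrightarrow> a (cof f) = h"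
  using X_active by (fastforce simp: active_flows_def)

lemma X_flows: "h \<in> {1..cores I} \<Longrightarrow> X n h \<subseteq> flows I"
  using X_active by (fastforce simp: active_flows_def)

lemma X_remaining: "h \<in> {1..cores I} \<Longrightarrow> f \<in> X n h \<Longrightarrow> 0 < R n f"
  using X_active by (fastforce simp: active_flows_def)

lemma X_ready:
  "h \<in> {1..cores I} \<Longrightarrow> f \<in> X n h \<Longrightarrow> k' \<in> predecessors I (cof f) \<Longrightarrow> f' \<in> flows_of I k' \<Longrightarrow> R n f' = 0"
  using X_active by (fastforce simp: active_flows_def)

lemma X_ports:
  assumes "h \<in> {1..cores I}"
  shows "inj_on inp (X n h)" "inj_on outp (X n h)"
  using X_greedy[OF assms] pick_greedily_ports[of "{}"] by (metis inj_on_empty)+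

lemma X_blocking:
  assumes "h \<in> {1..cores I}" "f \<in> active_flows I a h (e n) (R n)"
  shows "\<exists>g\<in>X n h. (inp g = inp f \<or> outp g = outp f) \<and> C (cof g) \<le> C (cof f)"
proof -
  obtain fs where fs: "set fs = active_flows I a h (e n) (R n)"
    "sorted_wrt (\<lambda>f g. C (cof f) \<le> C (cof g)) fs" "X n h = pick_greedily fs {}"
    using X_greedy[OF assms(1)] by blast
  show ?thesis
    using pick_greedily_blocking[of f fs "\<lambda>f g. C (cof f) \<le> C (cof g)" "{}"] fs assms(2) by auto
qed

lemma sending_flows: "sending n \<subseteq> flows I"
  using X_flows by blast

lemma finite_sending: "finite (sending n)"
  using sending_flows finite_flows[OF valid] finite_subset by blast

lemma sending_iff: "f \<in> flows I \<Longrightarrow> f \<in> sending n \<longleftrightarrow> f \<in> X n (a (cof f))"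
  using X_core core_of[OF cof_in_coflows] by (metis UN_iff)

lemma X_mem_iff:
  assumes "h \<in> {1..cores I}" "f \<in> flows I"
  shows "f \<in> X n h \<longleftrightarrow> h = a (cof f) \<and> f \<in> sending n"
proof
  show "f \<in> X n h \<Longrightarrow> h = a (cof f) \<and> f \<in> sending n"
    using X_core[OF assms(1)] assms(1) by blast
  show "h = a (cof f) \<and> f \<in> sending n \<Longrightarrow> f \<in> X n h"
    using sending_iff[OF assms(2)] by blast
qed

text \<open>All releases lie at time 0, so at a nonnegative event time no release is pending and
  only completions end an interval. The sign of \<open>e n\<close> is a hypothesis because it is
  established by an induction that uses this formula.\<close>

lemma \<delta>_eq:
  assumes "0 \<le> e n"
  shows "\<delta> n = (if sending n = {} then 0 else Min (R n ` sending n))"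
proof -
  have "{release I k - e n | k. k \<in> coflows I \<and> release I k > e n} = {}"
    using release_0 assms by auto
  then show ?thesis
    unfolding \<delta>_def time_to_event_def Let_def \<open>_ = {}\<close> by simp
qed

lemma sending_remaining: "f \<in> sending n \<Longrightarrow> 0 < R n f"
  using X_remaining by blast

lemma \<delta>_nonneg_if:
  assumes "0 \<le> e n"
  shows "0 \<le> \<delta> n"
proof (cases "sending n = {}")
  case False
  then have "Min (R n ` sending n) \<in> R n ` sending n"
    by (intro Min_in finite_imageI finite_sending) simp
  then obtain f where "f \<in> sending n" "Min (R n ` sending n) = R n f"
    by (rule imageE)
  then show ?thesis
    using \<delta>_eq[OF assms] False sending_remaining[of f n] by simp
qed (use \<delta>_eq[OF assms] in simp)

text \<open>The three claims need each other: the sign of \<open>e (Suc n)\<close> comes from that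
  of \<open>\<delta> n\<close>, the sign of \<open>\<delta>\<close> relies on that of
  \<open>e\<close>, and no volume turns negative because an interval never outlasts the smallest
  remaining volume being transmitted.\<close>

lemma event_invariant: "0 \<le> e n \<and> 0 \<le> \<delta> n \<and> (\<forall>f\<in>flows I. 0 \<le> R n f)"
proof (induction n)
  case 0
  show ?case
    using \<delta>_nonneg_if[of 0] by (simp add: e_0 R_0 less_imp_le size_of_pos)
next
  case (Suc n)
  have e: "0 \<le> e (Suc n)"
    using Suc by (simp add: e_Suc)
  have "0 \<le> \<delta> (Suc n)"
    using e by (rule \<delta>_nonneg_if)
  moreover have "0 \<le> R (Suc n) f" if "f \<in> flows I" for f
  proof (cases "f \<in> sending n")
    case True
    then have "\<delta> n \<le> R n f"
      using \<delta>_eq[of n] Suc Min_le[OF finite_imageI[OF finite_sending]] by (metis empty_iff imageI)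
    then show ?thesis
      using True by (simp add: R_Suc)
  qed (use Suc that in \<open>auto simp: R_Suc\<close>)
  ultimately show ?case
    using e by blast
qed

lemma e_nonneg: "0 \<le> e n" and \<delta>_nonneg: "0 \<le> \<delta> n" and R_nonneg: "f \<in> flows I \<Longrightarrow> 0 \<le> R n f"
  using event_invariant by auto

lemma e_mono: "m \<le> n \<Longrightarrow> e m \<le> e n"
  by (rule lift_Suc_mono_le[of e]) (use e_Suc \<delta>_nonneg in auto)

lemma R_antimono: "m \<le> n \<Longrightarrow> R n f \<le> R m f"
  by (rule lift_Suc_antimono_le[of "\<lambda>n. R n f"]) (use R_Suc \<delta>_nonneg in auto)

lemma R_zero_mono: "f \<in> flows I \<Longrightarrow> R m f = 0 \<Longrightarrow> m \<le> n \<Longrightarrow> R n f = 0"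
  using R_antimono R_nonneg by (metis order_antisym)

text \<open>Take an unfinished coflow all of whose predecessors are finished. Its unfinished flows
  are ready, so by greedy choice its core transmits one of them or a flow that blocks it.\<close>

lemma active_exists:
  assumes "f \<in> flows I" "R n f \<noteq> 0"
  shows "sending n \<noteq> {}"
proof -
  define Q where "Q = cof ` {f \<in> flows I. R n f \<noteq> 0}"
  have "Q \<noteq> {}"
    unfolding Q_def using assms by blast
  then obtain k where k: "k \<in> Q" "\<And>k'. k' \<in> predecessors I k \<Longrightarrow> k' \<notin> Q"
    using wfE_min'[OF wf_predecessors[OF valid], of Q] by auto
  then obtain g where g: "g \<in> flows I" "R n g \<noteq> 0" "cof g = k"
    by (auto simp: Q_def)
  have "R n g > 0"
    using g R_nonneg[of g n] by auto
  moreover have "R n f' = 0" if "k' \<in> predecessors I (cof g)" "f' \<in> flows_of I k'" for k' f'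
    using k(2)[of k'] that g(3) unfolding Q_def flows_of_def by blast
  ultimately have "g \<in> active_flows I a (a k) (e n) (R n)"
    using g release_0 cof_in_coflows[OF g(1)] e_nonneg[of n] by (simp add: active_flows_def)
  then show ?thesis
    using X_blocking[of "a k" g n] core_of cof_in_coflows[OF g(1)] g(3) by blast
qed

lemma all_complete: "\<exists>n. \<forall>f\<in>flows I. R n f = 0"
proof (rule ccontr)
  assume neg: "\<not> ?thesis"
  define U where "U n = {f \<in> flows I. R n f \<noteq> 0}" for n
  have fin: "finite (U n)" for n
    unfolding U_def using finite_flows[OF valid] by auto
  \<comment> \<open>The interval length is the least remaining volume among the transmitted flows,
    so the flow \<open>g\<close> attaining it finishes. The cardinalities would thus descend
    forever.\<close>
  have "card (U (Suc n)) < card (U n)" for n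
  proof -
    obtain f where "f \<in> flows I" "R n f \<noteq> 0"
      using neg by blast
    then have ne: "sending n \<noteq> {}"
      by (rule active_exists)
    then have "Min (R n ` sending n) \<in> R n ` sending n"
      by (intro Min_in finite_imageI finite_sending) simp
    then have "\<delta> n \<in> R n ` sending n"
      using \<delta>_eq[OF e_nonneg] ne by presburger
    then obtain g where g: "g \<in> sending n" "\<delta> n = R n g"
      by blast
    have "g \<notin> U (Suc n)"
      using g unfolding U_def R_Suc by simp
    moreover have "g \<in> U n"
      using g(1) sending_flows sending_remaining[OF g(1)] unfolding U_def by auto
    moreover have "U (Suc n) \<subseteq> U n"
      using R_zero_mono[of _ n "Suc n"] unfolding U_def by auto
    ultimately show ?thesis
      using fin psubset_card_mono by blast
  qed
  then show False
    using wf_no_infinite_down_chainE[OF wf_less, of "\<lambda>n. card (U n)"] by blast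
qed

section \<open>The run as a rate function and its feasibility\<close>

abbreviation S :: "'k schedule" where "S \<equiv> run_schedule I X"

text \<open>The half-open event intervals are disjoint, so the index in \<open>run_schedule\<close>
  is determined by \<open>t\<close>.\<close>

lemma schedule_at:
  assumes "e n \<le> t" "t < e (Suc n)"
  shows "S h f t = (if f \<in> X n h then 1 else 0)"
proof -
  have "m = n" if "e m \<le> t" "t < e (Suc m)" for m
  proof (rule ccontr)
    assume "m \<noteq> n"
    then have "Suc m \<le> n \<or> Suc n \<le> m"
      by auto
    then show False
      using e_mono[of "Suc m" n] e_mono[of "Suc n" m] assms that by auto
  qed
  then show ?thesis
    using assms unfolding run_schedule_def by metis
qed

lemma schedule_idle: "(\<And>n. e n \<le> t \<Longrightarrow> e (Suc n) \<le> t) \<Longrightarrow> S h f t = 0"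
  unfolding run_schedule_def by (meson not_le)

lemma schedule_nonneg: "0 \<le> S h f t"
  by (simp add: run_schedule_def)

text \<open>Before the final event, the least event beyond \<open>t\<close> closes the interval
  containing \<open>t\<close>; its index is not 0 because \<open>e 0 = 0\<close>.\<close>

lemma schedule_cases [consumes 1, case_names interval final]:
  assumes "0 \<le> t"
  obtains n where "e n \<le> t" "t < e (Suc n)" | N where "\<forall>f\<in>flows I. R N f = 0" "e N \<le> t"
proof -
  obtain N where N: "\<forall>f\<in>flows I. R N f = 0"
    by (rule exE[OF all_complete])
  show ?thesis
  proof (cases "e N \<le> t")
    case False
    define n where "n = (LEAST n. t < e n)"
    have n: "t < e n"
      using LeastI[of "\<lambda>n. t < e n" N] False unfolding n_def by (simp only: not_le)
    then have "n \<noteq> 0"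
      using assms e_0 by (metis not_le)
    then obtain m where m: "n = Suc m"
      using not0_implies_Suc by blast
    have "e m \<le> t"
      using not_less_Least[of m "\<lambda>n. t < e n"] m unfolding n_def[symmetric] by simp
    then show ?thesis
      using that(1) n m by blast
  qed (use N that in blast)
qed

lemma final_sending:
  assumes "\<forall>f\<in>flows I. R N f = 0" "N \<le> n"
  shows "sending n = {}"
proof (rule ccontr)
  assume "sending n \<noteq> {}"
  then obtain f where "f \<in> sending n"
    by blast
  then show False
    using sending_remaining[of f n] sending_flows[of n] R_zero_mono[of f N n] assms by auto
qed

text \<open>Once nothing is transmitted, \<open>time_to_event\<close> takes its default value 0 and
  the event times stop growing.\<close>

lemma final_event:
  assumes "\<forall>f\<in>flows I. R N f = 0"
  shows "e n \<le> e N"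
proof (cases "n \<le> N")
  case False
  then have "N \<le> n"
    by simp
  then show ?thesis
  proof (induction n rule: dec_induct)
    case (step n)
    then show ?case
      using \<delta>_eq[OF e_nonneg] final_sending[OF assms, of n] by (simp add: e_Suc)
  qed simp
qed (rule e_mono)

lemma final_idle:
  assumes "\<forall>f\<in>flows I. R N f = 0" "e N \<le> t"
  shows "S h f t = 0"
  by (rule schedule_idle) (use final_event[OF assms(1)] assms(2) order_trans in blast)

lemma schedule_interval_has_integral:
  assumes "e n \<le> t" "t \<le> e (Suc n)"
  shows "(S h f has_integral (if f \<in> X n h then t - e n else 0)) {e n..t}"
\<comment> \<open>The rate is constant on the interval except possibly at its right end, where the
  next event may change it.\<close>
proof (rule has_integral_spike_finite[of "{t}"])
  show "((\<lambda>_. if f \<in> X n h then 1 else 0) has_integral (if f \<in> X n h then t - e n else 0)) {e n..t}"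
    using has_integral_const_real[of "if f \<in> X n h then 1 else 0 :: real" "e n" t] assms(1) by auto
qed (use assms schedule_at in auto)

text \<open>A transmitted flow loses volume at rate 1, so on its own core the integral of its 0-1
  rate up to an event is the volume lost; on other cores the rate is 0.\<close>

lemma schedule_event_has_integral:
  assumes "h \<in> {1..cores I}" "f \<in> flows I"
  shows "(S h f has_integral (if h = a (cof f) then size_of I f - R n f else 0)) {0..e n}"
proof (induction n)
  case 0
  have "(S h f has_integral 0) {0..0}"
    using has_integral_refl(2)[of "S h f" 0] by simp
  then show ?case
    by (simp only: e_0 R_0 diff_self if_cancel)
next
  case (Suc n)
  have le: "e n \<le> e (Suc n)"
    by (rule e_mono) simp
  have "(S h f has_integral (if h = a (cof f) then size_of I f - R n f else 0)
      + (if f \<in> X n h then e (Suc n) - e n else 0)) {0..e (Suc n)}"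
    using e_nonneg le Suc schedule_interval_has_integral[OF le order_refl, where h = h and f = f]
    by (rule has_integral_combine)
  moreover have "(if h = a (cof f) then size_of I f - R n f else 0)
      + (if f \<in> X n h then e (Suc n) - e n else 0)
      = (if h = a (cof f) then size_of I f - R (Suc n) f else 0)"
    unfolding R_Suc e_Suc X_mem_iff[OF assms] by simp
  ultimately show ?case
    by simp
qed

lemma schedule_has_integral:
  assumes "h \<in> {1..cores I}" "f \<in> flows I" "e n \<le> t" "t \<le> e (Suc n)"
  shows "(S h f has_integral (if h = a (cof f)
      then size_of I f - R n f + (if f \<in> sending n then t - e n else 0) else 0)) {0..t}"
proof -
  have "(S h f has_integral (if h = a (cof f) then size_of I f - R n f else 0)
      + (if f \<in> X n h then t - e n else 0)) {0..t}"
    using e_nonneg assms(3) schedule_event_has_integral[OF assms(1,2)]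
      schedule_interval_has_integral[OF assms(3,4), where h = h and f = f]
    by (rule has_integral_combine)
  moreover have "(if h = a (cof f) then size_of I f - R n f else 0)
      + (if f \<in> X n h then t - e n else 0) = (if h = a (cof f)
      then size_of I f - R n f + (if f \<in> sending n then t - e n else 0) else 0)"
    unfolding X_mem_iff[OF assms(1,2)] by simp
  ultimately show ?thesis
    by simp
qed

lemma final_has_integral:
  assumes "h \<in> {1..cores I}" "f \<in> flows I" "\<forall>f\<in>flows I. R N f = 0" "e N \<le> t"
  shows "(S h f has_integral (if h = a (cof f) then size_of I f else 0)) {0..t}"
proof -
  have "(S h f has_integral 0) {e N..t}"
    by (rule has_integral_is_0) (use final_idle[OF assms(3)] in auto)
  with e_nonneg assms(4) schedule_event_has_integral[OF assms(1,2)]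
  have "(S h f has_integral (if h = a (cof f) then size_of I f - R N f else 0) + 0) {0..t}"
    by (rule has_integral_combine)
  then show ?thesis
    using assms(2,3) by (simp cong: if_cong)
qed

lemma sent_eqI:
  assumes "f \<in> flows I"
    and "\<And>h. h \<in> {1..cores I} \<Longrightarrow> (S h f has_integral (if h = a (cof f) then x else 0)) {0..t}"
  shows "sent I S f t = x"
proof -
  have "sent I S f t = (\<Sum>h = 1..cores I. if h = a (cof f) then x else 0)"
    unfolding sent_def by (rule sum.cong) (use assms(2) integral_unique in blast)+
  then show ?thesis
    using core_of[OF cof_in_coflows[OF assms(1)]] by simp
qed

lemma sent_interval:
  assumes "f \<in> flows I" "e n \<le> t" "t \<le> e (Suc n)"
  shows "sent I S f t = size_of I f - R n f + (if f \<in> sending n then t - e n else 0)"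
  using sent_eqI[OF assms(1)] schedule_has_integral[OF _ assms] by blast

lemma sent_event: "f \<in> flows I \<Longrightarrow> sent I S f (e n) = size_of I f - R n f"
  using sent_interval[of f n "e n"] e_mono[of n "Suc n"] by simp

lemma sent_final:
  assumes "f \<in> flows I" "\<forall>f\<in>flows I. R N f = 0" "e N \<le> t"
  shows "sent I S f t = size_of I f"
  using sent_eqI[OF assms(1)] final_has_integral[OF _ assms] by blast

lemma flow_completion_le_event:
  assumes "f \<in> flows I" "R n f = 0"
  shows "flow_completion I S f \<le> e n"
  unfolding flow_completion_def
  by (rule cInf_lower) (use assms e_nonneg sent_event in \<open>auto intro!: bdd_belowI[of _ 0]\<close>)

text \<open>\<open>port\<close> stands for \<open>inp\<close> or \<open>outp\<close>. Rates are 0 or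
  1, so the sum counts the flows transmitted through port \<open>i\<close>, and injectivity leaves
  at most one.\<close>

lemma port_capacity:
  assumes "h \<in> {1..cores I}" "0 \<le> t" "\<And>n. inj_on port (X n h)"
  shows "(\<Sum>f\<in>{f\<in>flows I. port f = i}. S h f t) \<le> 1"
  using assms(2)
proof (cases rule: schedule_cases)
  case (interval n)
  have fin: "finite {f\<in>flows I. port f = i}"
    using finite_flows[OF valid] by simp
  have "(\<Sum>f\<in>{f\<in>flows I. port f = i}. S h f t) = real (card {f\<in>flows I. port f = i \<and> f \<in> X n h})"
    using fin by (simp add: schedule_at[OF interval] sum.If_cases Int_def conj_assoc)
  moreover have "card {f\<in>flows I. port f = i \<and> f \<in> X n h} \<le> 1"
    using assms(3)[of n] finite_flows[OF valid]
    by (subst card_le_Suc0_iff_eq[unfolded One_nat_def[symmetric]]) (auto dest: inj_onD)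
  ultimately show ?thesis
    by linarith
next
  case (final N)
  then show ?thesis
    using final_idle by simp
qed

lemma schedule_feasible: "feasible I S"
  unfolding feasible_def
proof (intro conjI ballI allI impI)
  show "S h f integrable_on {0..t}" if "h \<in> {1..cores I}" "f \<in> flows I" "0 \<le> t" for h f t
    using that(3)
  proof (cases rule: schedule_cases)
    case (interval n)
    then show ?thesis
      using schedule_has_integral[OF that(1,2), of n t] by (auto simp: integrable_on_def)
  next
    case (final N)
    then show ?thesis
      using final_has_integral[OF that(1,2)] by (auto simp: integrable_on_def)
  qed
  show "sent I S f t \<le> size_of I f" if "f \<in> flows I" "0 \<le> t" for f t
    using that(2)
  proof (cases rule: schedule_cases)
    case (interval n)
    then show ?thesis
      using sent_interval[OF that(1), of n t] R_nonneg[OF that(1), of "Suc n"]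
        R_nonneg[OF that(1), of n] R_Suc[of n f] e_Suc[of n] by (auto split: if_splits)
  next
    case (final N)
    then show ?thesis
      using sent_final[OF that(1)] by simp
  qed
  show "\<exists>t\<ge>0. sent I S f t = size_of I f" if "f \<in> flows I" for f
  proof -
    obtain N where "\<forall>f\<in>flows I. R N f = 0"
      by (rule exE[OF all_complete])
    then show ?thesis
      using sent_final[OF that, of N "e N"] e_nonneg by auto
  qed
  show "S h f t = 0" if "f \<in> flows I" "0 \<le> t" "t < release I (cof f)" for h f t
    using that release_0 cof_in_coflows by fastforce
  show "S h f t = 0" if h: "h \<in> {1..cores I}" and "f \<in> flows I"
    and k': "k' \<in> predecessors I (cof f)" and f': "f' \<in> flows_of I k'"
    and t: "0 \<le> t" "t < flow_completion I S f'" for h f k' f' t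
    using t(1)
  proof (cases rule: schedule_cases)
    case (interval n)
    \<comment> \<open>A transmitted flow is ready at the start of the interval, so each predecessor
      flow has completed by \<open>e n \<le> t\<close>.\<close>
    have "f \<notin> X n h"
    proof
      assume "f \<in> X n h"
      then have "R n f' = 0"
        using X_ready[OF h _ k' f'] by blast
      then have "flow_completion I S f' \<le> e n"
        using flow_completion_le_event f' by (auto simp: flows_of_def)
      then show False
        using t(2) interval(1) by simp
    qed
    then show ?thesis
      using schedule_at[OF interval] by simp
  next
    case (final N)
    then show ?thesis
      using final_idle by simp
  qed
  show "(\<Sum>f\<in>{f\<in>flows I. inp f = i}. S h f t) \<le> 1" if "h \<in> {1..cores I}" "0 \<le> t" for h t i
    by (rule port_capacity[OF that X_ports(1)[OF that(1)]])
  show "(\<Sum>f\<in>{f\<in>flows I. outp f = j}. S h f t) \<le> 1" if "h \<in> {1..cores I}" "0 \<le> t" for h t j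
    by (rule port_capacity[OF that X_ports(2)[OF that(1)]])
qed (rule schedule_nonneg)

lemma schedule_indivisible: "indivisible I S"
  unfolding indivisible_def
proof
  fix k
  assume k: "k \<in> coflows I"
  have "S h' f t = 0" if "f \<in> flows_of I k" "h' \<in> {1..cores I}" "h' \<noteq> a k" for f h' t
  proof -
    have "f \<notin> X n h'" for n
      using X_core[of h' f n] that by (auto simp: flows_of_def)
    then show ?thesis
      by (simp add: run_schedule_def)
  qed
  then show "\<exists>h\<in>{1..cores I}. \<forall>f\<in>flows_of I k. \<forall>h'\<in>{1..cores I}. h' \<noteq> h \<longrightarrow> (\<forall>t\<ge>0. S h' f t = 0)"
    using core_of[OF k] by blast
qed

section \<open>Completion bounds along precedence paths\<close>

abbreviation ready :: "nat \<Rightarrow> 'k flow \<Rightarrow> bool" where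
  "ready n f \<equiv> \<forall>k'\<in>predecessors I (cof f). \<forall>f'\<in>flows_of I k'. R n f' = 0"

text \<open>An event index instead of a time, so that the delay can be summed interval by interval;
  for flows, \<open>all_complete\<close> ensures that the \<open>LEAST\<close> is attained.\<close>

definition finish :: "'k flow \<Rightarrow> nat" where "finish f = (LEAST n. R n f = 0)"

lemma finish:
  assumes "f \<in> flows I"
  shows "R (finish f) f = 0"
proof -
  obtain N where "\<forall>f\<in>flows I. R N f = 0"
    by (rule exE[OF all_complete])
  then have "R N f = 0"
    using assms by blast
  then show ?thesis
    unfolding finish_def by (rule LeastI[of "\<lambda>n. R n f = 0"])
qed

lemma not_finished: "n < finish f \<Longrightarrow> R n f \<noteq> 0"
  unfolding finish_def by (rule not_less_Least)

text \<open>The flow \<open>g\<close> blocking \<open>f\<close>, possibly \<open>f\<close> itself,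
  loses volume \<open>\<delta> n\<close> and occurs in one of the two sums because of the port it
  shares; all other terms are nonnegative.\<close>

lemma progress:
  assumes f: "f \<in> flows I" and unfinished: "R n f \<noteq> 0"
    and ready: "ready n f"
  shows "\<delta> n \<le> (\<Sum>g\<in>{g\<in>flows I. inp g = inp f \<and> C (cof g) \<le> C (cof f)}. R n g - R (Suc n) g)
    + (\<Sum>g\<in>{g\<in>flows I. outp g = outp f \<and> C (cof g) \<le> C (cof f)}. R n g - R (Suc n) g)"
    (is "_ \<le> sum ?d ?A + sum ?d ?B")
proof -
  let ?h = "a (cof f)"
  have h: "?h \<in> {1..cores I}"
    by (rule core_of[OF cof_in_coflows[OF f]])
  have "0 < R n f"
    using R_nonneg[OF f, of n] unfinished by simp
  then have "f \<in> active_flows I a ?h (e n) (R n)"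
    using f ready release_0 cof_in_coflows[OF f] e_nonneg[of n] by (simp add: active_flows_def)
  then obtain g where g: "g \<in> X n ?h" "inp g = inp f \<or> outp g = outp f" "C (cof g) \<le> C (cof f)"
    using X_blocking[OF h] by blast
  have "g \<in> flows I"
    using g(1) X_flows[OF h] by blast
  have "g \<in> sending n"
    using g(1) h by blast
  then have dg: "?d g = \<delta> n"
    by (simp add: R_Suc del: UN_iff)
  have d: "0 \<le> ?d g" for g
    using R_antimono[of n "Suc n" g] by simp
  have fin: "finite ?A" "finite ?B"
    using finite_flows[OF valid] by auto
  have nonneg: "0 \<le> sum ?d ?A" "0 \<le> sum ?d ?B"
    using d by (auto intro: sum_nonneg)
  from g(2) show ?thesis
  proof
    assume "inp g = inp f"
    then have "?d g \<le> sum ?d ?A"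
      using fin d g \<open>g \<in> flows I\<close> by (intro member_le_sum) auto
    then show ?thesis
      using dg nonneg by linarith
  next
    assume "outp g = outp f"
    then have "?d g \<le> sum ?d ?B"
      using fin d g \<open>g \<in> flows I\<close> by (intro member_le_sum) auto
    then show ?thesis
      using dg nonneg by linarith
  qed
qed

text \<open>From event \<open>m\<close> on, \<open>f\<close> stays ready, so summing
  \<open>progress\<close> up to \<open>finish f\<close> telescopes to the volumes drained at the two
  ports, and no flow loses more than its size.\<close>

lemma finish_delay:
  assumes f: "f \<in> flows I"
    and ready: "ready m f"
  shows "e (finish f) \<le> e m
    + (\<Sum>g\<in>{g\<in>flows I. inp g = inp f \<and> C (cof g) \<le> C (cof f)}. size_of I g)
    + (\<Sum>g\<in>{g\<in>flows I. outp g = outp f \<and> C (cof g) \<le> C (cof f)}. size_of I g)"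
    (is "_ \<le> _ + sum _ ?A + sum _ ?B")
proof -
  have *: "sum (\<lambda>g. R m g - R n g) Q \<le> sum (size_of I) Q" if "Q \<subseteq> flows I" for Q n
    using that R_nonneg[of _ n] R_antimono[of 0 m] unfolding R_0
    by (intro sum_mono) (smt (verit) le0 subsetD)
  have "0 \<le> sum (size_of I) Q" if "Q \<subseteq> flows I" for Q
    using that size_of_pos by (intro sum_nonneg) (auto intro: less_imp_le)
  then have nonneg: "0 \<le> sum (size_of I) ?A" "0 \<le> sum (size_of I) ?B"
    by auto
  show ?thesis
  proof (cases "finish f \<le> m")
    case True
    then show ?thesis
      using e_mono[OF True] nonneg by linarith
  next
    case False
    have "e n \<le> e m + sum (\<lambda>g. R m g - R n g) ?A + sum (\<lambda>g. R m g - R n g) ?B"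
      if "m \<le> n" "n \<le> finish f" for n
      using that
    proof (induction n rule: dec_induct)
      case (step n)
      have "R n f' = 0" if "k' \<in> predecessors I (cof f)" "f' \<in> flows_of I k'" for k' f'
      proof (rule R_zero_mono)
        show "R m f' = 0"
          using ready that by blast
      qed (use that step.hyps in \<open>auto simp: flows_of_def\<close>)
      then have "\<delta> n \<le> sum (\<lambda>g. R n g - R (Suc n) g) ?A + sum (\<lambda>g. R n g - R (Suc n) g) ?B"
        using progress[OF f not_finished[of n]] step.prems by auto
      moreover have "sum (\<lambda>g. R m g - R n g) Q + sum (\<lambda>g. R n g - R (Suc n) g) Q
          = sum (\<lambda>g. R m g - R (Suc n) g) Q" for Q
        by (simp add: sum.distrib[symmetric])
      ultimately show ?case
        using step.IH step.prems unfolding e_Suc by (smt (verit) Suc_leD)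
    qed simp
    from this[of "finish f"] show ?thesis
      using False *[of ?A "finish f"] *[of ?B "finish f"] by force
  qed
qed

context
  assumes lp: "lp_feasible I C"
begin

lemma finish_le_path:
  assumes "f \<in> flows I"
  shows "\<exists>p. prec_path I p \<and> p \<noteq> [] \<and> last p = cof f \<and>
    e (finish f) \<le> real (length p) * (4 * real (cores I) * C (cof f))"
  using wf_predecessors[OF valid] assms
proof (induction "cof f" arbitrary: f rule: wf_induct_rule)
  case less
  note f = less.prems
  \<comment> \<open>The factor 4 is 2 + 2: each of the two port loads is at most
    \<open>2 * real (cores I) * C (cof f)\<close>.\<close>
  let ?c = "4 * real (cores I) * C (cof f)"
  have delay: "e (finish f) \<le> e m + ?c"
    if ready: "ready m f" for m
  proof -
    note finish_delay[OF f ready]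
    moreover note lp_feasible_loads(1)[OF valid lp cof_in_coflows[OF f] inp_in_ports[OF f]]
    moreover note lp_feasible_loads(2)[OF valid lp cof_in_coflows[OF f] outp_in_ports[OF f]]
    ultimately show ?thesis
      by simp
  qed
  define Q where "Q = (\<Union>k'\<in>predecessors I (cof f). flows_of I k')"
  have Q: "Q \<subseteq> flows I"
    by (auto simp: Q_def flows_of_def)
  have finQ: "finite Q"
    by (rule finite_subset[OF Q finite_flows[OF valid]])
  show ?case
  proof (cases "Q = {}")
    case True
    \<comment> \<open>Without predecessor flows, \<open>f\<close> is ready at event 0, and its own
      coflow is the path.\<close>
    then have "e (finish f) \<le> e 0 + ?c"
      by (intro delay) (auto simp: Q_def)
    then show ?thesis
      using cof_in_coflows[OF f] by (intro exI[of _ "[cof f]"]) (auto simp: e_0)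
  next
    case False
    \<comment> \<open>At event \<open>m\<close> all predecessor flows have finished; the flow
      \<open>g\<close> finishing last supplies the path to be extended.\<close>
    define m where "m = Max (finish ` Q)"
    have "m \<in> finish ` Q"
      unfolding m_def using finQ False by (intro Max_in) auto
    then obtain g where g: "g \<in> Q" "m = finish g"
      by blast
    have pred: "cof g \<in> predecessors I (cof f)"
      using g by (auto simp: Q_def flows_of_def)
    have "e (finish f) \<le> e m + ?c"
    proof (rule delay, intro ballI)
      fix k' f'
      assume "k' \<in> predecessors I (cof f)" "f' \<in> flows_of I k'"
      then have "f' \<in> Q"
        by (auto simp: Q_def)
      then have "finish f' \<le> m" "f' \<in> flows I"
        using Q finQ by (auto simp: m_def)
      then show "R m f' = 0"
        using finish R_zero_mono by blast
    qed
    moreover obtain p where p: "prec_path I p" "p \<noteq> []" "last p = cof g"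
      "e m \<le> real (length p) * (4 * real (cores I) * C (cof g))"
      using less.hyps[of g] pred g Q by auto
    obtain q where q: "q \<noteq> []" "last q = cof f" "prec_path I (p @ q)"
      using prec_path_extend[OF valid pred p(1,2,3)] by blast
    have ports: "1 \<le> ports I"
      using inp_in_ports[OF f] by auto
    \<comment> \<open>Passing to the larger value \<open>C (cof f)\<close> lets every coflow on the
      path be charged the same amount \<open>?c\<close>.\<close>
    have "C (cof g) \<le> C (cof f)"
      by (rule lp_feasible_mono[OF lp ports pred])
    then have "real (length p) * (4 * real (cores I) * C (cof g)) \<le> real (length p) * ?c"
      by (intro mult_left_mono) auto
    ultimately have "e (finish f) \<le> (real (length p) + 1) * ?c"
      unfolding distrib_right mult_1 using p(4) by linarith
    \<comment> \<open>The additional \<open>?c\<close> is paid for by the extension: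
      \<open>q\<close> is nonempty, so the path gains at least one coflow.\<close>
    also have "\<dots> \<le> real (length (p @ q)) * ?c"
    proof (rule mult_right_mono)
      show "real (length p) + 1 \<le> real (length (p @ q))"
        using q(1) by (cases q) auto
      show "0 \<le> ?c"
        using lp_feasible_nonneg[OF valid lp cof_in_coflows[OF f] ports] by simp
    qed
    finally show ?thesis
      using q by (intro exI[of _ "p @ q"]) auto
  qed
qed

lemma flow_completion_le:
  assumes "f \<in> flows I"
  shows "flow_completion I S f \<le> 4 * real (cores I) * real (max_path_coflows I) * C (cof f)"
proof -
  obtain p where p: "prec_path I p" "e (finish f) \<le> real (length p) * (4 * real (cores I) * C (cof f))"
    using finish_le_path[OF assms] by blast
  have "0 \<le> C (cof f)"
    by (rule lp_feasible_nonneg[OF valid lp cof_in_coflows[OF assms]])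
      (use inp_in_ports[OF assms] in auto)
  then have "real (length p) * (4 * real (cores I) * C (cof f))
      \<le> real (max_path_coflows I) * (4 * real (cores I) * C (cof f))"
    using length_prec_path_le[OF valid p(1)] by (intro mult_right_mono) auto
  then show ?thesis
    using flow_completion_le_event[OF assms finish[OF assms]] p(2) by (simp add: mult_ac)
qed

lemma completion_le:
  assumes k: "k \<in> coflows I" and ports: "1 \<le> ports I"
  shows "completion I S k \<le> 4 * real (cores I) * real (max_path_coflows I) * C k"
proof -
  have fin: "finite (flows_of I k')" for k'
    using finite_flows[OF valid] by (simp add: flows_of_def)
  show ?thesis
  proof (cases "flows_of I k = {}")
    case False
    then show ?thesis
      using flow_completion_le fin by (auto simp: completion_def flows_of_def)
  next
    case True
    let ?Q = "\<Union>k'\<in>predecessors I k. flows_of I k'"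
    have Q: "finite ?Q"
      by (rule finite_subset[OF _ finite_flows[OF valid]]) (auto simp: flows_of_def)
    \<comment> \<open>A coflow without flows completes with the flows of its predecessors, whose
      bounds carry over because \<open>C\<close> is monotone along predecessors.\<close>
    have "flow_completion I S f \<le> 4 * real (cores I) * real (max_path_coflows I) * C k" if "f \<in> ?Q" for f
    proof -
      have f: "f \<in> flows I" "cof f \<in> predecessors I k"
        using that by (auto simp: flows_of_def)
      have "4 * real (cores I) * real (max_path_coflows I) * C (cof f)
          \<le> 4 * real (cores I) * real (max_path_coflows I) * C k"
        using lp_feasible_mono[OF lp ports f(2)] by (intro mult_left_mono) auto
      then show ?thesis
        using flow_completion_le[OF f(1)] by linarith
    qed
    moreover have "release I k \<le> 4 * real (cores I) * real (max_path_coflows I) * C k"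
      using release_0 k lp_feasible_nonneg[OF valid lp k ports] by simp
    ultimately show ?thesis
      using True Q unfolding completion_def by (subst if_not_P) (auto simp del: UN_iff)
  qed
qed

end

end

section \<open>Completion times of feasible schedules satisfy the linear program\<close>

text \<open>By assumption, \<open>L k * C k\<close> is at least the sum of \<open>L k * L k'\<close>
  over the \<open>k'\<close> on the same core with \<open>C k' \<le> C k\<close>. Summed over
  \<open>k\<close> and doubled, this counts every ordered pair on a common core at least once and
  the diagonal twice, which gives the squares plus the squared core loads. Cauchy-Schwarz over the
  \<open>m\<close> cores brings in the square of the total load.\<close>

lemma quadratic_lower_bound:
  fixes L C :: "'k \<Rightarrow> real" and core :: "'k \<Rightarrow> nat"
  assumes "finite A" "\<And>k. 0 \<le> L k" "1 \<le> m" "\<And>k. k \<in> A \<Longrightarrow> core k \<in> {1..m}"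
    and C: "\<And>k. k \<in> A \<Longrightarrow> (\<Sum>k'\<in>{k'\<in>A. core k' = core k \<and> C k' \<le> C k}. L k') \<le> C k"
  shows "(\<Sum>k\<in>A. L k * C k) \<ge> 1 / (2 * real m) * ((\<Sum>k\<in>A. (L k)\<^sup>2) + (\<Sum>k\<in>A. L k)\<^sup>2)"
proof -
  define q where "q k k' = (if core k' = core k then L k * L k' else 0)" for k k'
  define x where "x h = (\<Sum>k\<in>A. if core k = h then L k else 0)" for h
  let ?U = "\<Sum>k\<in>A. \<Sum>k'\<in>A. if C k' \<le> C k then q k k' else 0"
  have q: "q k k' = q k' k" "0 \<le> q k k'" for k k'
    using assms(2) by (auto simp: q_def)
  have "?U \<le> (\<Sum>k\<in>A. L k * C k)"
  proof (rule sum_mono)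
    fix k assume k: "k \<in> A"
    have "(\<Sum>k'\<in>A. if C k' \<le> C k then q k k' else 0)
        = (\<Sum>k'\<in>A. if core k' = core k \<and> C k' \<le> C k then L k * L k' else 0)"
      by (rule sum.cong) (auto simp: q_def)
    also have "\<dots> = L k * (\<Sum>k'\<in>{k'\<in>A. core k' = core k \<and> C k' \<le> C k}. L k')"
      using assms(1) by (simp add: sum.inter_filter sum_distrib_left if_distrib[of "(*) _"] cong: if_cong)
    also have "\<dots> \<le> L k * C k"
      using C[OF k] assms(2) by (intro mult_left_mono)
    finally show "(\<Sum>k'\<in>A. if C k' \<le> C k then q k k' else 0) \<le> L k * C k" .
  qed
  moreover have "(\<Sum>k\<in>A. (L k)\<^sup>2) + (\<Sum>k\<in>A. \<Sum>k'\<in>A. q k k') \<le> 2 * ?U"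
  proof -
    \<comment> \<open>Exchanging the roles of \<open>k\<close> and \<open>k'\<close> uses the
      symmetry of \<open>q\<close>; the two forms together cover every ordered pair, since
      \<open>C k\<close> and \<open>C k'\<close> are comparable.\<close>
    have "?U = (\<Sum>k\<in>A. \<Sum>k'\<in>A. if C k \<le> C k' then q k k' else 0)"
      by (subst sum.swap) (simp add: q(1) cong: if_cong)
    then have "2 * ?U = (\<Sum>k\<in>A. \<Sum>k'\<in>A. (if C k' \<le> C k then q k k' else 0) + (if C k \<le> C k' then q k k' else 0))"
      by (simp add: sum.distrib)
    moreover have "(\<Sum>k\<in>A. (L k)\<^sup>2) = (\<Sum>k\<in>A. \<Sum>k'\<in>A. if k' = k then q k k' else 0)"
      using assms(1) by (simp add: q_def power2_eq_square)
    moreover have "(\<Sum>k\<in>A. \<Sum>k'\<in>A. (if k' = k then q k k' else 0) + q k k')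
        \<le> (\<Sum>k\<in>A. \<Sum>k'\<in>A. (if C k' \<le> C k then q k k' else 0) + (if C k \<le> C k' then q k k' else 0))"
      by (intro sum_mono) (use q(2) in auto)
    ultimately show ?thesis
      by (simp add: sum.distrib)
  qed
  moreover have "(\<Sum>k\<in>A. L k)\<^sup>2 \<le> real m * (\<Sum>k\<in>A. \<Sum>k'\<in>A. q k k')"
  proof -
    have "(\<Sum>h\<in>{1..m}. x h) = (\<Sum>k\<in>A. \<Sum>h\<in>{1..m}. if core k = h then L k else 0)"
      unfolding x_def by (rule sum.swap)
    also have "\<dots> = (\<Sum>k\<in>A. L k)"
      by (rule sum.cong) (use assms(4) in auto)
    \<comment> \<open>Cauchy-Schwarz for the core loads \<open>x h\<close>.\<close>
    finally have "(\<Sum>k\<in>A. L k)\<^sup>2 \<le> real m * (\<Sum>h\<in>{1..m}. (x h)\<^sup>2)"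
      using sum_squared_le_sum_of_squares[of x "{1..m}"] by (simp add: mult.commute)
    also have "(\<Sum>h\<in>{1..m}. (x h)\<^sup>2)
        = (\<Sum>h\<in>{1..m}. \<Sum>k\<in>A. \<Sum>k'\<in>A. if core k = h then q k k' else 0)"
      unfolding x_def power2_eq_square sum_product
      by (intro sum.cong refl) (auto simp: q_def)
    also have "\<dots> = (\<Sum>k\<in>A. \<Sum>k'\<in>A. \<Sum>h\<in>{1..m}. if core k = h then q k k' else 0)"
      by (subst sum.swap) (intro sum.cong refl sum.swap)
    also have "\<dots> = (\<Sum>k\<in>A. \<Sum>k'\<in>A. q k k')"
      by (intro sum.cong refl) (use assms(4) in auto)
    finally show ?thesis .
  qed
  \<comment> \<open>As \<open>m\<close> is at least 1, the squares too may be multiplied by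
    \<open>m\<close>, so that both terms carry the same factor.\<close>
  moreover have "(\<Sum>k\<in>A. (L k)\<^sup>2) \<le> real m * (\<Sum>k\<in>A. (L k)\<^sup>2)"
    using assms(3) mult_right_mono[of 1 "real m" "\<Sum>k\<in>A. (L k)\<^sup>2"] by (simp add: sum_nonneg)
  moreover have "real m * ((\<Sum>k\<in>A. (L k)\<^sup>2) + (\<Sum>k\<in>A. \<Sum>k'\<in>A. q k k')) \<le> real m * (2 * (\<Sum>k\<in>A. L k * C k))"
    using calculation(1,2) by (intro mult_left_mono) auto
  ultimately have "(\<Sum>k\<in>A. (L k)\<^sup>2) + (\<Sum>k\<in>A. L k)\<^sup>2 \<le> real m * (2 * (\<Sum>k\<in>A. L k * C k))"
    by (simp add: distrib_left)
  then show ?thesis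
    using assms(3) by (simp add: field_simps)
qed

section \<open>Volumes and completion times in an arbitrary feasible indivisible schedule\<close>

locale indivisible_schedule =
  fixes I :: "'k coflow_instance" and T :: "'k schedule" and core :: "'k \<Rightarrow> nat"
  assumes valid: "valid_instance I"
    and release_0: "\<forall>k\<in>coflows I. release I k = 0"
    and feasible: "feasible I T"
    and core: "k \<in> coflows I \<Longrightarrow> core k \<in> {1..cores I}"
    and other_cores: "k \<in> coflows I \<Longrightarrow> f \<in> flows_of I k \<Longrightarrow> h \<in> {1..cores I} \<Longrightarrow> h \<noteq> core k
      \<Longrightarrow> 0 \<le> t \<Longrightarrow> T h f t = 0"
begin

lemma rate_nonneg: "h \<in> {1..cores I} \<Longrightarrow> f \<in> flows I \<Longrightarrow> 0 \<le> t \<Longrightarrow> 0 \<le> T h f t"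
  and rate_integrable: "h \<in> {1..cores I} \<Longrightarrow> f \<in> flows I \<Longrightarrow> 0 \<le> t \<Longrightarrow> T h f integrable_on {0..t}"
  using feasible unfolding feasible_def by blast+

lemma rate_zero_before:
  assumes "h \<in> {1..cores I}" "f \<in> flows I" "k' \<in> predecessors I (cof f)" "f' \<in> flows_of I k'"
    and "0 \<le> t" "t < flow_completion I T f'"
  shows "T h f t = 0"
  using feasible assms unfolding feasible_def by blast

lemma sent_eq_integral:
  assumes "f \<in> flows I" "0 \<le> t"
  shows "sent I T f t = integral {0..t} (T (core (cof f)) f)"
proof -
  have f: "cof f \<in> coflows I" "f \<in> flows_of I (cof f)"
    using assms(1) cof_in_coflows by (simp_all add: flows_of_def)
  have "integral {0..t} (T h f) = 0" if "h \<in> {1..cores I}" "h \<noteq> core (cof f)" for h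
    using integral_cong[of "{0..t}" "T h f" "\<lambda>_. 0"] other_cores[OF f that] by simp
  then have "sent I T f t
      = (\<Sum>h = 1..cores I. if h = core (cof f) then integral {0..t} (T h f) else 0)"
    unfolding sent_def by (intro sum.cong) auto
  then show ?thesis
    using core[OF f(1)] by simp
qed

lemma sent_mono:
  assumes "f \<in> flows I" "0 \<le> s" "s \<le> t"
  shows "sent I T f s \<le> sent I T f t"
proof -
  have h: "core (cof f) \<in> {1..cores I}"
    by (rule core[OF cof_in_coflows[OF assms(1)]])
  have "integral {0..s} (T (core (cof f)) f) \<le> integral {0..t} (T (core (cof f)) f)"
    by (rule integral_subset_le) (use assms rate_integrable[OF h] rate_nonneg[OF h] in auto)
  then show ?thesis
    using assms by (simp add: sent_eq_integral)
qed

text \<open>The volume sent is an indefinite integral, hence continuous, so the infimum defining the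
  completion time is attained.\<close>

lemma flow_completion_attained:
  assumes "f \<in> flows I"
  shows "0 \<le> flow_completion I T f" "size_of I f \<le> sent I T f (flow_completion I T f)"
proof -
  obtain t0 where t0: "0 \<le> t0" "sent I T f t0 = size_of I f"
    using bspec[OF feasible[unfolded feasible_def, THEN conjunct2, THEN conjunct2, THEN conjunct2,
          THEN conjunct2, THEN conjunct1] assms] by (elim exE conjE)
  have "continuous_on {0..t0} (\<lambda>t. integral {0..t} (T (core (cof f)) f))"
    by (rule indefinite_integral_continuous_1)
      (rule rate_integrable[OF core[OF cof_in_coflows[OF assms]] assms t0(1)])
  then have "continuous_on {0..t0} (sent I T f)"
    by (rule continuous_on_eq) (use sent_eq_integral[OF assms] in auto)
  \<comment> \<open>\<open>t0\<close> is a time by which \<open>f\<close> is complete, so cutting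
    the set off at \<open>t0\<close> leaves its infimum unchanged.\<close>
  then have closed: "closed {t\<in>{0..t0}. size_of I f \<le> sent I T f t}" (is "closed ?B")
    by (intro continuous_on_closed_Collect_le continuous_on_const) auto
  have B: "?B \<noteq> {}" "bdd_below ?B"
    using t0 by (auto intro!: bdd_belowI[of _ 0])
  then have Inf: "Inf ?B \<in> ?B"
    using closed by (rule closed_contains_Inf)
  have "flow_completion I T f = Inf ?B"
    unfolding flow_completion_def
  proof (rule cInf_eq_minimum)
    fix t assume t: "t \<in> {t. 0 \<le> t \<and> size_of I f \<le> sent I T f t}"
    show "Inf ?B \<le> t"
    proof (cases "t \<le> t0")
      case True
      then show ?thesis
        using t B(2) by (intro cInf_lower) auto
    qed (use Inf in auto)
  qed (use Inf in auto)
  then show "0 \<le> flow_completion I T f" "size_of I f \<le> sent I T f (flow_completion I T f)"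
    using Inf by auto
qed

text \<open>All of \<open>A\<close> passes through core \<open>h\<close> between \<open>s\<close>
  and \<open>u\<close> at total rate at most 1. The maximum with 0 covers \<open>u < s\<close>, when
  nothing can be sent.\<close>

lemma transmission_volume:
  assumes h: "h \<in> {1..cores I}" and A: "A \<subseteq> flows I" "\<And>f. f \<in> A \<Longrightarrow> core (cof f) = h"
    and cap: "\<And>t. 0 \<le> t \<Longrightarrow> (\<Sum>f\<in>A. T h f t) \<le> 1"
    and s: "0 \<le> s" "\<And>f t. f \<in> A \<Longrightarrow> 0 \<le> t \<Longrightarrow> t < s \<Longrightarrow> T h f t = 0"
    and u: "0 \<le> u" "\<And>f. f \<in> A \<Longrightarrow> flow_completion I T f \<le> u"
  shows "(\<Sum>f\<in>A. size_of I f) \<le> max 0 (u - s)"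
proof -
  let ?F = "\<lambda>t. \<Sum>f\<in>A. T h f t"
  define v where "v = min s u"
  have v: "0 \<le> v" "v \<le> u" "v \<le> s"
    using s(1) u(1) by (auto simp: v_def)
  have fin: "finite A"
    using A(1) finite_flows[OF valid] finite_subset by blast
  have int: "T h f integrable_on {0..u}" if "f \<in> A" for f
    using rate_integrable[OF h _ u(1)] that A(1) by blast
  have intF: "?F integrable_on {0..u}"
    using fin int by (intro integrable_sum)
  have "(\<Sum>f\<in>A. size_of I f) \<le> (\<Sum>f\<in>A. integral {0..u} (T h f))"
  proof (rule sum_mono)
    fix f assume f: "f \<in> A"
    then have "f \<in> flows I"
      using A(1) by blast
    then show "size_of I f \<le> integral {0..u} (T h f)"
      using flow_completion_attained[of f] sent_mono[of f "flow_completion I T f" u] u f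
        sent_eq_integral[of f u] A(2)[OF f] by auto
  qed
  also have "\<dots> = integral {0..u} ?F"
    using integral_sum[OF fin int] by simp
  also have "\<dots> = integral {0..v} ?F + integral {v..u} ?F"
    using Henstock_Kurzweil_Integration.integral_combine[OF v(1,2) intF] by simp
  \<comment> \<open>The rates vanish before \<open>s\<close>; the point \<open>v\<close> may
    coincide with \<open>s\<close> and is removed as a null set.\<close>
  also have "integral {0..v} ?F = integral {0..v} (\<lambda>_. 0)"
    by (rule integral_spike[of "{v}"]) (use s(2) v in auto)
  also have "integral {v..u} ?F \<le> integral {v..u} (\<lambda>_. 1)"
    by (rule integral_le) (use integrable_subinterval_real[OF intF] v cap in auto)
  also have "\<dots> = max 0 (u - s)"
    using v(2) by (auto simp: v_def min_def max_def)
  finally show ?thesis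
    by simp
qed

lemma flow_completion_le_completion:
  assumes "f \<in> flows_of I k"
  shows "flow_completion I T f \<le> completion I T k"
proof -
  have "finite (flows_of I k)"
    using finite_flows[OF valid] by (simp add: flows_of_def)
  then show ?thesis
    using assms unfolding completion_def by auto
qed

lemma completion_nonneg:
  assumes "k \<in> coflows I"
  shows "0 \<le> completion I T k"
proof (cases "flows_of I k = {}")
  case True
  have "finite (\<Union>k'\<in>predecessors I k. flows_of I k')"
    by (rule finite_subset[OF _ finite_flows[OF valid]]) (auto simp: flows_of_def)
  then show ?thesis
    using True release_0 assms by (simp add: completion_def Max_ge_iff)
next
  case False
  then obtain f where f: "f \<in> flows_of I k"
    by blast
  then have "0 \<le> flow_completion I T f"
    by (intro flow_completion_attained) (simp add: flows_of_def)
  then show ?thesis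
    using flow_completion_le_completion[OF f] by linarith
qed

text \<open>Completion times are attained maxima; this reduces statements on coflows, including
  those without flows, to single flows.\<close>

lemma completion_cases:
  assumes "k \<in> coflows I"
  shows "completion I T k = 0 \<or>
    (\<exists>k'\<in>insert k (predecessors I k). \<exists>f\<in>flows_of I k'. completion I T k = flow_completion I T f)"
proof (cases "flows_of I k = {}")
  case True
  let ?Q = "insert (release I k) (flow_completion I T ` (\<Union>k'\<in>predecessors I k. flows_of I k'))"
  have "finite (\<Union>k'\<in>predecessors I k. flows_of I k')"
    by (rule finite_subset[OF _ finite_flows[OF valid]]) (auto simp: flows_of_def)
  then have "Max ?Q \<in> ?Q"
    by (intro Max_in) auto
  moreover have "completion I T k = Max ?Q"
    using True by (simp add: completion_def)
  ultimately show ?thesis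
    using release_0 assms by auto
next
  case False
  have "finite (flows_of I k)"
    using finite_flows[OF valid] by (simp add: flows_of_def)
  then have "Max (flow_completion I T ` flows_of I k) \<in> flow_completion I T ` flows_of I k"
    using False by (intro Max_in) auto
  then show ?thesis
    using False unfolding completion_def by auto
qed

text \<open>Feasibility speaks of single predecessor flows. Since \<open>completion I T k'\<close>
  exceeds \<open>t \<ge> 0\<close>, it is the completion time of a flow of \<open>k'\<close> or of a
  predecessor of \<open>k'\<close>, and the latter also precedes \<open>k\<close>.\<close>

lemma rate_zero_before_completion:
  assumes "k' \<in> predecessors I k" "f \<in> flows_of I k" "h \<in> {1..cores I}" "0 \<le> t" "t < completion I T k'"
  shows "T h f t = 0"
proof -
  obtain k'' f' where "k'' \<in> insert k' (predecessors I k')" "f' \<in> flows_of I k''"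
    "completion I T k' = flow_completion I T f'"
    using completion_cases[OF predecessors_in_coflows(1)[OF valid assms(1)]] assms(4,5) by auto
  moreover from this have "k'' \<in> predecessors I (cof f)"
    using assms(1,2) predecessors_trans[of k'' I k' k] by (auto simp: flows_of_def)
  moreover have "f \<in> flows I"
    using assms(2) by (simp add: flows_of_def)
  ultimately show ?thesis
    using rate_zero_before[OF assms(3)] assms(4,5) by metis
qed

text \<open>By transitivity, the flows that can determine the completion of \<open>k'\<close> all
  enter the maximum for \<open>k\<close>.\<close>

lemma completion_mono_no_flows:
  assumes "k' \<in> predecessors I k" "flows_of I k = {}"
  shows "completion I T k' \<le> completion I T k"
proof -
  let ?Q = "\<Union>k'\<in>predecessors I k. flows_of I k'"
  have k: "k' \<in> coflows I" "k \<in> coflows I"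
    using predecessors_in_coflows[OF valid assms(1)] by auto
  have fin: "finite ?Q"
    by (rule finite_subset[OF _ finite_flows[OF valid]]) (auto simp: flows_of_def)
  from completion_cases[OF k(1)] show ?thesis
  proof
    assume "\<exists>k''\<in>insert k' (predecessors I k'). \<exists>f\<in>flows_of I k''.
      completion I T k' = flow_completion I T f"
    then obtain k'' f where f: "k'' \<in> insert k' (predecessors I k')" "f \<in> flows_of I k''"
      "completion I T k' = flow_completion I T f"
      by blast
    have "k'' \<in> predecessors I k"
      using f(1) assms(1) predecessors_trans by auto
    then have "f \<in> ?Q"
      using f(2) by blast
    then show ?thesis
      using f(3) assms(2) fin by (simp add: completion_def del: UN_iff)
  qed (use completion_nonneg[OF k(2)] in simp)
qed

text \<open>\<open>P\<close> selects the flows at one fixed port and \<open>L\<close> is the load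
  there, so input and output ports are treated alike.\<close>

context
  fixes P :: "'k flow \<Rightarrow> bool" and L :: "'k \<Rightarrow> real"
  assumes cap: "\<And>h t. h \<in> {1..cores I} \<Longrightarrow> 0 \<le> t \<Longrightarrow> (\<Sum>f\<in>{f\<in>flows I. P f}. T h f t) \<le> 1"
    and L: "\<And>k. k \<in> coflows I \<Longrightarrow> L k = (\<Sum>f\<in>{f\<in>flows_of I k. P f}. size_of I f)"
begin

lemma subset_capacity:
  assumes "h \<in> {1..cores I}" "0 \<le> t" "A \<subseteq> {f\<in>flows I. P f}"
  shows "(\<Sum>f\<in>A. T h f t) \<le> 1"
proof -
  have "(\<Sum>f\<in>A. T h f t) \<le> (\<Sum>f\<in>{f\<in>flows I. P f}. T h f t)"
    by (rule sum_mono2) (use assms finite_flows[OF valid] rate_nonneg in auto)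
  then show ?thesis
    using cap[OF assms(1,2)] by linarith
qed

text \<open>With \<open>s\<close> the completion time of a predecessor this yields the precedence
  constraints, with \<open>s = 0\<close> the release constraints.\<close>

lemma load_le_completion_diff:
  assumes k: "k \<in> coflows I" and s: "0 \<le> s"
    and zero: "\<And>f t. f \<in> flows_of I k \<Longrightarrow> 0 \<le> t \<Longrightarrow> t < s \<Longrightarrow> T (core k) f t = 0"
  shows "L k \<le> max 0 (completion I T k - s)"
  unfolding L[OF k]
proof (rule transmission_volume[OF core[OF k]])
  show "(\<Sum>f\<in>{f\<in>flows_of I k. P f}. T (core k) f t) \<le> 1" if "0 \<le> t" for t
    by (rule subset_capacity[OF core[OF k] that]) (auto simp: flows_of_def)
  show "flow_completion I T f \<le> completion I T k" if "f \<in> {f\<in>flows_of I k. P f}" for f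
    using flow_completion_le_completion that by auto
qed (use s zero completion_nonneg[OF k] in \<open>auto simp: flows_of_def\<close>)

lemma load_le_completion: "k \<in> coflows I \<Longrightarrow> L k \<le> completion I T k"
  using load_le_completion_diff[of k 0] completion_nonneg by fastforce

lemma quadratic_completion_bound:
  assumes A: "A \<subseteq> coflows I"
  shows "(\<Sum>k\<in>A. L k * completion I T k)
    \<ge> 1 / (2 * real (cores I)) * ((\<Sum>k\<in>A. (L k)\<^sup>2) + (\<Sum>k\<in>A. L k)\<^sup>2)"
proof -
  have fin: "finite A"
    using A valid finite_subset by (auto simp: valid_instance_def)
  \<comment> \<open>\<open>quadratic_lower_bound\<close> asks for nonnegative loads everywhere,
    whereas \<open>L\<close> is specified on \<open>coflows I\<close>; hence the extension by
    0.\<close>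
  define L' where "L' k = (if k \<in> A then L k else 0)" for k
  have "0 \<le> L k" if "k \<in> A" for k
    using L[of k] that A by (auto intro!: sum_nonneg size_of_nonneg)
  then have L': "0 \<le> L' k" for k
    by (simp add: L'_def)
  have "(\<Sum>k'\<in>{k'\<in>A. core k' = core k \<and> completion I T k' \<le> completion I T k}. L' k') \<le> completion I T k"
    if k: "k \<in> A" for k
  proof -
    let ?K = "{k'\<in>A. core k' = core k \<and> completion I T k' \<le> completion I T k}"
    have kI: "k \<in> coflows I"
      using k A by blast
    have K: "?K \<subseteq> coflows I"
      using A by blast
    have "(\<Sum>k'\<in>?K. L' k') = (\<Sum>k'\<in>?K. \<Sum>f\<in>{f\<in>flows_of I k'. P f}. size_of I f)"
      by (rule sum.cong) (use L K in \<open>auto simp: L'_def\<close>)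
    also have "\<dots> = (\<Sum>f\<in>{f\<in>flows I. P f \<and> cof f \<in> ?K}. size_of I f)"
      by (rule sum_flows_of[OF valid K, symmetric])
    also have "\<dots> \<le> max 0 (completion I T k - 0)"
    proof (rule transmission_volume[OF core[OF kI]])
      show "(\<Sum>f\<in>{f\<in>flows I. P f \<and> cof f \<in> ?K}. T (core k) f t) \<le> 1" if "0 \<le> t" for t
        by (rule subset_capacity[OF core[OF kI] that]) auto
      show "flow_completion I T f \<le> completion I T k" if "f \<in> {f\<in>flows I. P f \<and> cof f \<in> ?K}" for f
        using flow_completion_le_completion[of f "cof f"] that by (auto simp: flows_of_def)
    qed (use completion_nonneg[OF kI] in auto)
    finally show ?thesis
      using completion_nonneg[OF kI] by simp
  qed
  then have "(\<Sum>k\<in>A. L' k * completion I T k)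
    \<ge> 1 / (2 * real (cores I)) * ((\<Sum>k\<in>A. (L' k)\<^sup>2) + (\<Sum>k\<in>A. L' k)\<^sup>2)"
    by (intro quadratic_lower_bound[where core = core] fin L')
      (use A core valid in \<open>auto simp: valid_instance_def\<close>)
  then show ?thesis
    by (simp add: L'_def cong: sum.cong)
qed

end

lemma input_capacity:
  assumes "i \<in> {1..ports I}" "h \<in> {1..cores I}" "0 \<le> t"
  shows "(\<Sum>f\<in>{f\<in>flows I. inp f = i}. T h f t) \<le> 1"
  using feasible assms unfolding feasible_def by blast

lemma output_capacity:
  assumes "j \<in> {1..ports I}" "h \<in> {1..cores I}" "0 \<le> t"
  shows "(\<Sum>f\<in>{f\<in>flows I. outp f = j}. T h f t) \<le> 1"
  using feasible assms unfolding feasible_def by blast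

text \<open>If \<open>k\<close> has a flow \<open>f\<close>, the load of \<open>k\<close> at the
  input port of \<open>f\<close> is positive and is sent only after \<open>k'\<close> completes, so
  the maximum with 0 in the load bound cannot be 0.\<close>

lemma completion_predecessor_le:
  assumes "k' \<in> predecessors I k"
  shows "completion I T k' \<le> completion I T k"
proof (cases "flows_of I k = {}")
  case False
  have k: "k' \<in> coflows I" "k \<in> coflows I"
    using predecessors_in_coflows[OF valid assms] by auto
  obtain f where f: "f \<in> flows_of I k"
    using False by blast
  have fI: "f \<in> flows I"
    using f by (simp add: flows_of_def)
  have L: "0 < (\<Sum>g\<in>{g\<in>flows_of I k. inp g = inp f}. size_of I g)"
    by (rule sum_pos2[of _ f]) (use f size_of_pos[OF fI] finite_flows[OF valid] size_of_nonneg in \<open>simp_all add: flows_of_def\<close>)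
  have "(\<Sum>g\<in>{g\<in>flows_of I k. inp g = inp f}. size_of I g) \<le> max 0 (completion I T k - completion I T k')"
    by (rule load_le_completion_diff[where L = "\<lambda>k. \<Sum>g\<in>{g\<in>flows_of I k. inp g = inp f}. size_of I g"
          and P = "\<lambda>g. inp g = inp f"])
      (use input_capacity[OF inp_in_ports[OF fI]] k completion_nonneg
        rate_zero_before_completion[OF assms _ core[OF k(2)]] in auto)
  then show ?thesis
    using L by linarith
qed (use completion_mono_no_flows assms in simp)

lemma lp_feasible_completion: "lp_feasible I (completion I T)"
proof -
  have diff: "completion I T k' + L k \<le> completion I T k"
    if "\<And>h t. h \<in> {1..cores I} \<Longrightarrow> 0 \<le> t \<Longrightarrow> (\<Sum>f\<in>{f\<in>flows I. P f}. T h f t) \<le> 1"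
      "\<And>k. k \<in> coflows I \<Longrightarrow> L k = (\<Sum>f\<in>{f\<in>flows_of I k. P f}. size_of I f)" "(k', k) \<in> prec I"
    for P L k k'
  proof -
    have pred: "k' \<in> predecessors I k"
      using that(3) by (auto simp: predecessors_def)
    have k: "k' \<in> coflows I" "k \<in> coflows I"
      using predecessors_in_coflows[OF valid pred] by auto
    have "L k \<le> max 0 (completion I T k - completion I T k')"
      by (rule load_le_completion_diff[of P L, OF that(1,2) k(2) completion_nonneg[OF k(1)]
            rate_zero_before_completion[OF pred _ core[OF k(2)]]])
    \<comment> \<open>Monotonicity along predecessors makes the difference nonnegative, which
      removes the maximum with 0.\<close>
    then show ?thesis
      using completion_predecessor_le[OF pred] by linarith
  qed
  show ?thesis
    unfolding lp_feasible_def
  proof (intro conjI ballI allI impI; (clarify)?)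
    fix k i assume "k \<in> coflows I" "i \<in> {1..ports I}"
    then show "release I k + L_in I i k \<le> completion I T k"
      using load_le_completion[OF input_capacity L_in_eq_sum_flows] release_0 by simp
  next
    fix k j assume "k \<in> coflows I" "j \<in> {1..ports I}"
    then show "release I k + L_out I j k \<le> completion I T k"
      using load_le_completion[OF output_capacity L_out_eq_sum_flows] release_0 by simp
  next
    fix k' k i assume "(k', k) \<in> prec I" "i \<in> {1..ports I}"
    then show "completion I T k' + L_in I i k \<le> completion I T k"
      using diff[OF input_capacity L_in_eq_sum_flows] by simp
  next
    fix k' k j assume "(k', k) \<in> prec I" "j \<in> {1..ports I}"
    then show "completion I T k' + L_out I j k \<le> completion I T k"
      using diff[OF output_capacity L_out_eq_sum_flows] by simp
  qed (use quadratic_completion_bound[OF input_capacity L_in_eq_sum_flows]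
      quadratic_completion_bound[OF output_capacity L_out_eq_sum_flows] in simp)+
qed

end

section \<open>The approximation ratio\<close>

lemma core_assignment_core:
  assumes "core_assignment I C ks a" "k \<in> coflows I"
  shows "a k \<in> {1..cores I}"
proof -
  obtain n where "n < length ks" "ks ! n = k"
    using assms in_set_conv_nth[of k ks] by (auto simp: core_assignment_def)
  then show ?thesis
    using assms(1) unfolding core_assignment_def is_arg_min_def by blast
qed

text \<open>Without ports every \<open>C\<close> satisfies \<open>lp_feasible\<close>, so this case
  is settled directly: there are no flows and each coflow completes at its release time 0.\<close>

lemma objective_no_ports:
  assumes "valid_instance I" "\<forall>k\<in>coflows I. release I k = 0" "ports I = 0"
  shows "objective I T = 0"
proof -
  have "flows_of I k = {}" for k
    using assms(3) by (auto simp: flows_of_def flows_def)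
  then have "completion I T k = release I k" for k
    by (simp add: completion_def)
  then show ?thesis
    using assms(2) by (simp add: objective_def)
qed

lemma max_path_coflows_pos:
  assumes "valid_instance I" "coflows I \<noteq> {}"
  shows "1 \<le> max_path_coflows I"
proof -
  obtain k where "k \<in> coflows I"
    using assms(2) by blast
  then show ?thesis
    using length_prec_path_le[OF assms(1), of "[k]"] by simp
qed

lemma objective_le:
  assumes valid: "valid_instance I" and release: "\<forall>k\<in>coflows I. release I k = 0"
    and lp: "lp_optimal I C" and ca: "core_assignment I C ks a" and run: "list_scheduling_run I C a X"
    and T: "feasible I T" "indivisible I T"
  shows "objective I (run_schedule I X)
    \<le> 4 * real (cores I) * real (max_path_coflows I) * objective I T"
proof (cases "ports I = 0")
  case True
  then show ?thesis
    by (simp add: objective_no_ports[OF valid release])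
next
  case False
  let ?c = "4 * real (cores I) * real (max_path_coflows I)"
  interpret zero_release_run I C a X
    using valid release run core_assignment_core[OF ca] by unfold_locales
  \<comment> \<open>The core that each coflow uses in the competing schedule \<open>T\<close> is
    picked by choice from indivisibility.\<close>
  obtain core where "\<forall>k\<in>coflows I. core k \<in> {1..cores I} \<and> (\<forall>f\<in>flows_of I k.
      \<forall>h\<in>{1..cores I}. h \<noteq> core k \<longrightarrow> (\<forall>t\<ge>0. T h f t = 0))"
    by (rule exE[OF bchoice[OF T(2)[unfolded indivisible_def Bex_def]]])
  then interpret T: indivisible_schedule I T core
    using valid release T(1) by unfold_locales blast+
  have w: "0 \<le> weight I k" if "k \<in> coflows I" for k
    using valid that by (simp add: valid_instance_def)
  have "objective I (run_schedule I X) \<le> (\<Sum>k\<in>coflows I. weight I k * (?c * C k))"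
    unfolding objective_def using lp False w
    by (intro sum_mono mult_left_mono completion_le) (auto simp: lp_optimal_def)
  also have "\<dots> = ?c * (\<Sum>k\<in>coflows I. weight I k * C k)"
    by (simp add: sum_distrib_left mult_ac)
  also have "\<dots> \<le> ?c * objective I T"
    using lp T.lp_feasible_completion by (intro mult_left_mono) (auto simp: lp_optimal_def objective_def)
  finally show ?thesis .
qed

theorem theorem4:
  fixes I :: "'k coflow_instance" and S :: "'k schedule"
  assumes "valid_instance I"
    and "\<forall>k\<in>coflows I. release I k = 0"
    and "coflow_driven_list_scheduling I S"
  shows "feasible I S \<and> indivisible I S \<and>
    objective I S \<le> 4 * real (cores I) * real (max_path_coflows I) * optimum I"
proof -
  obtain C ks a X where alg: "lp_optimal I C" "core_assignment I C ks a"
    "list_scheduling_run I C a X" and S: "S = run_schedule I X"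
    using assms(3) unfolding coflow_driven_list_scheduling_def by blast
  interpret zero_release_run I C a X
    using assms(1,2) alg(3) core_assignment_core[OF alg(2)] by unfold_locales
  have S_valid: "feasible I S" "indivisible I S"
    unfolding S by (rule schedule_feasible schedule_indivisible)+
  have "objective I S \<le> 4 * real (cores I) * real (max_path_coflows I) * optimum I"
  proof (cases "coflows I = {}")
    case True
    \<comment> \<open>The empty path is the only one, so both sides are 0.\<close>
    then have "max_path_coflows I = 0"
      by (simp add: max_path_coflows_def)
    then show ?thesis
      using True by (simp add: objective_def)
  next
    case False
    let ?c = "4 * real (cores I) * real (max_path_coflows I)"
    have c: "0 < ?c"
      using assms(1) max_path_coflows_pos[OF assms(1) False] by (simp add: valid_instance_def)
    \<comment> \<open>\<open>optimum\<close> is an infimum, so the bound is divided by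
      \<open>?c\<close>, shown against every competing schedule and multiplied back. The run itself
      shows that the set of competitors is nonempty.\<close>
    have "objective I S / ?c \<le> optimum I"
      unfolding optimum_def
    proof (rule cINF_greatest)
      show "{T. feasible I T \<and> indivisible I T} \<noteq> {}"
        using S_valid by blast
      show "objective I S / ?c \<le> objective I T" if "T \<in> {T. feasible I T \<and> indivisible I T}" for T
        using objective_le[OF assms(1,2) alg, of T] that c
        unfolding S by (simp only: pos_divide_le_eq mult.commute mem_Collect_eq)
    qed
    then show ?thesis
      using c by (simp only: pos_divide_le_eq mult.commute)
  qed
  then show ?thesis
    using S_valid by blast
qed

end
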